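(* Let $S$ be the algebraic surface defined by a nonconstant square-free polynomial $F\in\mathbb{R}[x,y,z]$ with no nonconstant factor depending only on $z$, and such that, if $\deg_y(F)>0$, the leading coefficient of $F$ with respect to $y$ does not depend on $x$. Let $\mathcal{A}\subset\mathbb{R}$ be the critical level set of $S$ computed from the polynomials $M(x,z)$ and $R(z)$ as described in the context. Then $S$ is real if and only if there exists $a\in\mathbb{R}$ with $a\notin\mathcal{A}$ such that the level curve $S_a$ of $S$ is real.
   Context: Reality. The surface $S$ defined by $F(x,y,z)=0$ is called real if $S\cap\mathbb{R}^3=\{(x,y,z)\in\mathbb{R}^3: F(x,y,z)=0\}$ has dimension two (in the usual Euclidean topology). For $a\in\mathbb{R}$, the level curve $S_a$ is the intersection of $S$ with the plane $z=a$, viewed as the plane algebraic curve defined by $F(x,y,a)=0$. It is called real if its real part $\{(x,y)\in\mathbb{R}^2: F(x,y,a)=0\}$ has dimension one (equivalently, is infinite). Notation. For a polynomial $G$ and a variable $w$ with $\deg_w(G)>0$, $D_w(G):=\mathrm{Res}_w\left(G,\frac{\partial G}{\partial w}\right)$, the Sylvester resultant with respect to $w$; in particular, if $\deg_w(G)=1$, then $D_w(G)$ is the leading coefficient of $G$ with respect to $w$. $\sqrt{G}$ denotes the square-free part of $G$ (the product of the distinct irreducible factors of $G$, defined up to a nonzero constant factor). For $F\in\mathbb{R}[x,y,z]$ put $$M(x,z):=\begin{cases}0 & \text{if }\deg_y(F)=0,\\ \sqrt{D_y(F)} & \text{otherwise,}\end{cases}\qquad R(z):=\begin{cases}0 & \text{if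 } \deg_x(M)=0 \text{ (including } M=0),\\ D_x(M(x,z)) & \text{otherwise.}\end{cases}$$ The set $\mathcal{A}\subset\mathbb{R}$ is defined as follows: (1) if $R(z)$ is not identically zero, $\mathcal{A}$ is the set of real roots of $R(z)$; (2) if $R$ and $M$ are both identically zero, $\mathcal{A}$ is the set of real roots of $D_x(F)$; (3) if $R$ is identically zero but $M$ is not identically zero (so $M=M(z)$ depends only on $z$), $\mathcal{A}$ is the set of real roots of $M(z)$. *)

theory Defs
  imports
    "HOL-Analysis.Analysis"
    "HOL-Computational_Algebra.Computational_Algebra"
    "HOL-Computational_Algebra.Field_as_Ring"
    "Subresultants.Resultant_Prelim"
begin

text \<open>A polynomial in \<open>\<real>[x,y,z]\<close> is an element of \<open>\<real>[z][x][y]\<close>: in the type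
  \<open>real poly poly poly\<close> the outermost variable is \<open>y\<close>, the middle one \<open>x\<close>, the innermost
  one \<open>z\<close>.  Likewise \<open>real poly poly\<close> is \<open>\<real>[z][x]\<close> and \<open>real poly\<close> is \<open>\<real>[z]\<close>; so
  \<^const>\<open>degree\<close> is \<open>deg_y\<close>, \<open>deg_x\<close>, \<open>deg_z\<close> respectively.\<close>

definition eval_xyz :: "real poly poly poly \<Rightarrow> real \<Rightarrow> real \<Rightarrow> real \<Rightarrow> real" where
  "eval_xyz F x y z = poly (poly (poly F [:[:y:]:]) [:x:]) z"

definition real_surface_points :: "real poly poly poly \<Rightarrow> (real \<times> real \<times> real) set" where
  "real_surface_points F = {(x, y, z). eval_xyz F x y z = 0}"

definition real_level_points :: "real poly poly poly \<Rightarrow> real \<Rightarrow> (real \<times> real) set" where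
  "real_level_points F a = {(x, y). eval_xyz F x y a = 0}"

text \<open>Topological dimension exactly \<open>n\<close>; the relation \<^const>\<open>dimension_le\<close> is the library's
  (small inductive) dimension of a topological space.\<close>

definition has_dimension :: "'a::topological_space set \<Rightarrow> int \<Rightarrow> bool" where
  "has_dimension X n \<longleftrightarrow> top_of_set X dim_le n \<and> \<not> top_of_set X dim_le (n - 1)"

definition surface_real :: "real poly poly poly \<Rightarrow> bool" where
  "surface_real F \<longleftrightarrow> has_dimension (real_surface_points F) 2"

definition level_curve_real :: "real poly poly poly \<Rightarrow> real \<Rightarrow> bool" where
  "level_curve_real F a \<longleftrightarrow> has_dimension (real_level_points F a) 1"

text \<open>\<open>Res\<^sub>w(G, \<partial>G/\<partial>w)\<close> for the outermost variable \<open>w\<close> of \<open>G\<close>, without normalisation by the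
  leading coefficient.  It is meant for \<open>deg\<^sub>w G > 0\<close>; for \<open>deg\<^sub>w G = 1\<close> the Sylvester
  matrix is 1 by 1 and the value is the leading coefficient.\<close>

definition disc_res :: "'a::idom poly \<Rightarrow> 'a" where
  "disc_res G = resultant G (pderiv G)"

text \<open>\<^const>\<open>prime_factors\<close> picks one normalised representative of each class of associated
  irreducible factors; the units of \<open>\<real>[z][x]\<close> are the nonzero constants, so this is the
  square-free part up to a nonzero constant.\<close>

definition sqfree_part :: "real poly poly \<Rightarrow> real poly poly" where
  "sqfree_part G = (if G = 0 then 0 else \<Prod>(prime_factors G))"

definition poly_M :: "real poly poly poly \<Rightarrow> real poly poly" where
  "poly_M F = (if degree F = 0 then 0 else sqfree_part (disc_res F))"

definition poly_R :: "real poly poly poly \<Rightarrow> real poly" where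
  "poly_R F = (if degree (poly_M F) = 0 then 0 else disc_res (poly_M F))"

text \<open>If \<open>M = 0\<close> then, for square-free \<open>F\<close> without nonconstant factor in \<open>\<real>[z]\<close> and with
  leading coefficient in \<open>\<real>[z]\<close>, \<open>deg_y F = 0\<close>, so \<open>F\<close>, as an element of \<open>\<real>[z][x]\<close>, is
  \<open>coeff F 0\<close>.  If \<open>R = 0 \<noteq> M\<close>, then \<open>deg_x M = 0\<close>, so \<open>M\<close>, as an element of \<open>\<real>[z]\<close>, is
  \<open>coeff M 0\<close>.\<close>

definition critical_levels :: "real poly poly poly \<Rightarrow> real set" where
  "critical_levels F =
     (if poly_R F \<noteq> 0 then {a. poly (poly_R F) a = 0}
      else if poly_M F = 0 then {a. poly (disc_res (coeff F 0)) a = 0}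
      else {a. poly (coeff (poly_M F) 0) a = 0})"

end

theory Submission
  imports Defs "Subresultants.Subresultant_Gcd"
begin

text \<open>
  Upper bounds for the dimension come from cutting with boxes: if almost all axis-parallel slices
  of a set have dimension at most \<open>n - 1\<close>, the set has dimension at most \<open>n\<close>.  This bounds surface
  and level curves by 2 and 1.  For lower bounds, a connected set with two points is not
  zero-dimensional, and a plane disc is not one-dimensional because a zero-dimensional compact set
  does not separate the plane.

  Let \<open>deg\<^sub>y F > 0\<close> and \<open>D = D\<^sub>y(F)\<close>.  At a point of \<open>S\<close> with \<open>D(x,z) \<noteq> 0\<close> also \<open>F\<^sub>y \<noteq> 0\<close>, so \<open>S\<close> is
  locally a graph over the \<open>(x,z)\<close>-plane, hence two-dimensional, and all nearby level curves contain
  arcs.  If \<open>a \<notin> \<A>\<close>, then \<open>D(\<cdot>,a)\<close> is not identically zero and the leading coefficient of \<open>F\<close> does not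
  vanish at \<open>a\<close>, so only finitely many points of \<open>S\<^sub>a\<close> have \<open>D = 0\<close> and an infinite \<open>S\<^sub>a\<close> contains a
  point as above.  Conversely, \<open>S \<inter> {D = 0}\<close> has dimension at most 1, so a real surface contains
  such a point, and \<open>\<A>\<close> is finite.  If \<open>deg\<^sub>y F = 0\<close>, the surface is a cylinder over the curve
  \<open>F(x,z) = 0\<close> and \<open>D\<^sub>x(F)\<close> plays the role of \<open>D\<close>.
\<close>

section \<open>Small inductive dimension of subsets of Euclidean space\<close>

text \<open>Order \<open>n\<close> encodes dimension at most \<open>n - 1\<close>, so that order 0
  is left to the empty set, of dimension -1. Countably many bad slices are allowed: countability
  survives finite unions, and every open interval still contains good values.\<close>

fun axis_thin :: "nat \<Rightarrow> 'a::euclidean_space set \<Rightarrow> bool" where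
  "axis_thin 0 T \<longleftrightarrow> T = {}"
| "axis_thin (Suc n) T \<longleftrightarrow>
     (\<forall>i\<in>Basis. \<exists>C. countable C \<and> (\<forall>c. c \<notin> C \<longrightarrow> axis_thin n (T \<inter> {x. inner x i = c})))"

declare axis_thin.simps(2) [simp del]

lemma axis_thin_SucD:
  "axis_thin (Suc n) T \<Longrightarrow> i \<in> Basis
    \<Longrightarrow> \<exists>C. countable C \<and> (\<forall>c. c \<notin> C \<longrightarrow> axis_thin n (T \<inter> {x. inner x i = c}))"
  unfolding axis_thin.simps by (rule bspec)

lemma axis_thin_SucI:
  assumes "\<And>i. i \<in> Basis
    \<Longrightarrow> \<exists>C. countable C \<and> (\<forall>c. c \<notin> C \<longrightarrow> axis_thin n (T \<inter> {x. inner x i = c}))"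
  shows "axis_thin (Suc n) T"
  unfolding axis_thin.simps by (intro ballI assms)

lemma axis_thin_subset: "axis_thin n T \<Longrightarrow> S \<subseteq> T \<Longrightarrow> axis_thin n S"
proof (induction n arbitrary: S T)
  case 0
  then show ?case by simp
next
  case (Suc n)
  show ?case
  proof (rule axis_thin_SucI)
    fix i :: 'a assume i: "i \<in> Basis"
    obtain C where C: "countable C" "\<forall>c. c \<notin> C \<longrightarrow> axis_thin n (T \<inter> {x. inner x i = c})"
      using axis_thin_SucD[OF Suc.prems(1) i] by blast
    have "axis_thin n (S \<inter> {x. inner x i = c})" if "c \<notin> C" for c
      by (rule Suc.IH[OF C(2)[rule_format, OF that]]) (use Suc.prems(2) in blast)
    with C(1) show "\<exists>C. countable C \<and> (\<forall>c. c \<notin> C \<longrightarrow> axis_thin n (S \<inter> {x. inner x i = c}))"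
      by (intro exI[of _ C] conjI allI impI)
  qed
qed

lemma axis_thin_empty [simp]: "axis_thin n {}"
proof (induction n)
  case (Suc n)
  then show ?case
    by (intro axis_thin_SucI exI[of _ "{}"]) simp
qed simp

lemma axis_thin_Un: "axis_thin n S \<Longrightarrow> axis_thin n T \<Longrightarrow> axis_thin n (S \<union> T)"
proof (induction n arbitrary: S T)
  case 0
  then show ?case by simp
next
  case (Suc n)
  show ?case
  proof (rule axis_thin_SucI)
    fix i :: 'a assume i: "i \<in> Basis"
    obtain C where C: "countable C" "\<forall>c. c \<notin> C \<longrightarrow> axis_thin n (S \<inter> {x. inner x i = c})"
      using axis_thin_SucD[OF Suc.prems(1) i] by blast
    obtain D where D: "countable D" "\<forall>c. c \<notin> D \<longrightarrow> axis_thin n (T \<inter> {x. inner x i = c})"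
      using axis_thin_SucD[OF Suc.prems(2) i] by blast
    have "axis_thin n ((S \<union> T) \<inter> {x. inner x i = c})" if "c \<notin> C \<union> D" for c
      using Suc.IH C(2) D(2) that unfolding Int_Un_distrib2 by blast
    with C(1) D(1) show "\<exists>C. countable C \<and> (\<forall>c. c \<notin> C \<longrightarrow> axis_thin n ((S \<union> T) \<inter> {x. inner x i = c}))"
      by (intro exI[of _ "C \<union> D"] conjI allI impI) simp_all
  qed
qed

lemma axis_thin_UN: "finite I \<Longrightarrow> (\<And>j. j \<in> I \<Longrightarrow> axis_thin n (S j)) \<Longrightarrow> axis_thin n (\<Union>j\<in>I. S j)"
  by (induction I rule: finite_induct) (auto intro: axis_thin_Un)

lemma countable_imp_axis_thin:
  assumes "countable T"
  shows "axis_thin 1 T"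
proof -
  have "\<exists>C. countable C \<and> (\<forall>c. c \<notin> C \<longrightarrow> T \<inter> {x. inner x i = c} = {})" for i
    using assms by (intro exI[of _ "(\<lambda>x. inner x i) ` T"]) auto
  then show ?thesis
    by (simp add: axis_thin.simps(2))
qed

lemma ex_between_avoiding_countable:
  fixes a b :: real
  assumes "a < b" "countable C"
  shows "\<exists>c. a < c \<and> c < b \<and> c \<notin> C"
proof (rule ccontr)
  assume "\<not> ?thesis"
  then have "{a<..<b} \<subseteq> C" by auto
  then show False
    using assms countable_subset uncountable_open_interval by blast
qed

lemma ex_box_avoiding_countable:
  fixes a :: "'a::euclidean_space"
  assumes "open W" "a \<in> W" and C: "\<And>i. i \<in> Basis \<Longrightarrow> countable (C i)"
  obtains l u where "a \<in> box l u" "box l u \<subseteq> W"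
    "\<And>i. i \<in> Basis \<Longrightarrow> inner l i \<notin> C i \<and> inner u i \<notin> C i"
proof -
  obtain e where e: "e > 0" "ball a e \<subseteq> W"
    using assms(1,2) by (auto simp: open_contains_ball)
  \<comment> \<open>If every coordinate difference is below \<open>d\<close>, then the sum of their
    absolute values, which bounds the Euclidean norm, is below \<open>e\<close>.\<close>
  define d where "d = e / real DIM('a)"
  have "d > 0" using e by (simp add: d_def)
  have "\<forall>i\<in>Basis. \<exists>c. inner a i - d < c \<and> c < inner a i \<and> c \<notin> C i"
    using \<open>d > 0\<close> C by (intro ballI ex_between_avoiding_countable) auto
  then obtain p where p: "\<And>i. i \<in> Basis \<Longrightarrow> inner a i - d < p i \<and> p i < inner a i \<and> p i \<notin> C i"
    by metis
  have "\<forall>i\<in>Basis. \<exists>c. inner a i < c \<and> c < inner a i + d \<and> c \<notin> C i"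
    using \<open>d > 0\<close> C by (intro ballI ex_between_avoiding_countable) auto
  then obtain q where q: "\<And>i. i \<in> Basis \<Longrightarrow> inner a i < q i \<and> q i < inner a i + d \<and> q i \<notin> C i"
    by metis
  define l where "l = (\<Sum>i\<in>Basis. p i *\<^sub>R i)"
  define u where "u = (\<Sum>i\<in>Basis. q i *\<^sub>R i)"
  have l: "inner l i = p i" and u: "inner u i = q i" if "i \<in> Basis" for i
    using that by (auto simp: l_def u_def)
  have "x \<in> ball a e" if "x \<in> box l u" for x
  proof -
    have lt: "\<bar>inner (x - a) i\<bar> < d" if i: "i \<in> Basis" for i
    proof -
      have "p i < inner x i" "inner x i < q i"
        using \<open>x \<in> box l u\<close> i l u by (simp_all add: mem_box)
      then show ?thesis
        using p[OF i] q[OF i] unfolding inner_diff_left by linarith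
    qed
    have "norm (x - a) \<le> (\<Sum>i\<in>Basis. \<bar>inner (x - a) i\<bar>)"
      by (rule norm_le_l1)
    also have "\<dots> < (\<Sum>i\<in>(Basis::'a set). d)"
      by (rule sum_strict_mono) (use lt in auto)
    also have "\<dots> = e" by (simp add: d_def)
    finally show ?thesis by (simp add: dist_norm norm_minus_commute)
  qed
  then have "box l u \<subseteq> W" using e(2) by blast
  moreover have "a \<in> box l u"
    using p q l u by (simp add: mem_box)
  moreover have "inner l i \<notin> C i \<and> inner u i \<notin> C i" if "i \<in> Basis" for i
    using p[OF that] q[OF that] l[OF that] u[OF that] by simp
  ultimately show thesis by (intro that[of l u])
qed

text \<open>Each point has small box neighbourhoods whose faces avoid the countably many exceptional
  slices, so the frontiers of these neighbourhoods are thin of the next lower order.\<close>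

lemma axis_thin_imp_dim_le: "axis_thin n T \<Longrightarrow> top_of_set T dim_le (int n - 1)"
proof (induction n arbitrary: T)
  case 0
  then show ?case by simp
next
  case (Suc n)
  from Suc.prems have "\<forall>i\<in>Basis. \<exists>C. countable C \<and> (\<forall>c. c \<notin> C \<longrightarrow> axis_thin n (T \<inter> {x. inner x i = c}))"
    by (simp add: axis_thin.simps(2))
  then obtain C where C: "\<And>i. i \<in> Basis \<Longrightarrow> countable (C i)"
    "\<And>i c. i \<in> Basis \<Longrightarrow> c \<notin> C i \<Longrightarrow> axis_thin n (T \<inter> {x. inner x i = c})"
    by metis
  show ?case
  proof (rule dimension_le.intros)
    fix V a
    assume "openin (top_of_set T) V" "a \<in> V"
    then obtain W where W: "open W" "V = T \<inter> W" "a \<in> T" "a \<in> W"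
      by (auto simp: openin_open)
    obtain l u where lu: "a \<in> box l u" "box l u \<subseteq> W"
      "\<And>i. i \<in> Basis \<Longrightarrow> inner l i \<notin> C i \<and> inner u i \<notin> C i"
      using ex_box_avoiding_countable[OF W(1,4), of C] C(1) by blast
    let ?B = "T \<inter> box l u"
    let ?Fr = "top_of_set T frontier_of ?B"
    let ?N = "\<Union>i\<in>Basis. (T \<inter> {x. inner x i = inner l i}) \<union> (T \<inter> {x. inner x i = inner u i})"
    have "axis_thin n ?N"
      using lu(3) C(2) by (intro axis_thin_UN axis_thin_Un) auto
    moreover have "?Fr \<subseteq> ?N"
    proof
      fix x assume x: "x \<in> ?Fr"
      have "x \<in> T"
        using x frontier_of_subset_subtopology[of euclidean T ?B] by (rule rev_subsetD)
      \<comment> \<open>The right-hand side reads \<open>(?B \<union> ?Fr) - ?B\<close>: a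
        relatively open set is disjoint from its frontier.\<close>
      have "?Fr = ?B \<union> ?Fr - ?B"
      proof -
        have "openin (top_of_set T) ?B"
          by (simp add: openin_open_Int open_box)
        then show ?thesis
          by (auto simp: frontier_of_def interior_of_openin)
      qed
      then have nb: "x \<notin> box l u" using x \<open>x \<in> T\<close> by blast
      have "x \<in> closure ?B"
        using x by (auto simp: frontier_of_def closure_of_subtopology)
      then have "x \<in> closure (box l u)"
        using closure_mono[of ?B "box l u"] by blast
      then have "x \<in> cbox l u"
        using closure_minimal[OF box_subset_cbox closed_cbox] by blast
      with nb obtain i where "i \<in> Basis" "inner x i = inner l i \<or> inner x i = inner u i"
        unfolding mem_box by (metis order_le_less)
      then show "x \<in> ?N" using \<open>x \<in> T\<close> by blast
    qed
    ultimately have "axis_thin n ?Fr"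
      by (rule axis_thin_subset)
    then have "top_of_set ?Fr dim_le (int n - 1)"
      by (rule Suc.IH)
    moreover have "subtopology (top_of_set T) ?Fr = top_of_set ?Fr"
      by (simp add: subtopology_subtopology Int_absorb1 frontier_of_subset_subtopology)
    ultimately show "\<exists>U. a \<in> U \<and> U \<subseteq> V \<and> openin (top_of_set T) U
        \<and> subtopology (top_of_set T) (top_of_set T frontier_of U) dim_le int (Suc n) - 1 - 1"
      using lu(1,2) W(2,3) by (intro exI[of _ ?B]) (auto simp: openin_open_Int open_box)
  qed simp
qed

text \<open>Induction on the number of free directions \<open>B\<close>, the other coordinates being
  fixed to those of \<open>q\<close>. For \<open>i\<close> in \<open>B\<close> the line through
  \<open>q\<close> in direction \<open>i\<close> is not contained in the zero set, so it meets it
  finitely often. For every other value \<open>c\<close> of this coordinate, the point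
  \<open>r\<close> of the line takes over the role of \<open>q\<close>, with one free direction
  less.\<close>

lemma axis_thin_zero_set:
  fixes f :: "'a::euclidean_space \<Rightarrow> real"
  assumes "\<And>p i. i \<in> Basis \<Longrightarrow> finite {t. f (p + t *\<^sub>R i) = 0} \<or> (\<forall>t. f (p + t *\<^sub>R i) = 0)"
    and "B \<subseteq> Basis" "f q \<noteq> 0"
  shows "axis_thin (card B) {x. f x = 0 \<and> (\<forall>i\<in>Basis - B. inner x i = inner q i)}"
  using assms(2,3)
proof (induction "card B" arbitrary: B q)
  case 0
  then have "B = {}"
    using finite_subset[of B Basis] by auto
  then have "x = q" if "\<forall>i\<in>Basis - B. inner x i = inner q i" for x
    using that by (auto intro: euclidean_eqI)
  with 0 show ?case by auto
next
  case (Suc n)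
  let ?V = "\<lambda>B q. {x. f x = 0 \<and> (\<forall>i\<in>Basis - B. inner x i = inner q i)}"
  have fin: "finite B" by (rule finite_subset[OF Suc.prems(1) finite_Basis])
  have "\<exists>C. countable C \<and> (\<forall>c. c \<notin> C \<longrightarrow> axis_thin n (?V B q \<inter> {x. inner x i = c}))"
    if i: "i \<in> Basis" for i
  proof (cases "i \<in> B")
    case True
    let ?C = "(\<lambda>t. inner q i + t) ` {t. f (q + t *\<^sub>R i) = 0}"
    have "finite {t. f (q + t *\<^sub>R i) = 0}"
      using assms(1)[OF i, of q] Suc.prems(2) by (metis add.right_neutral scaleR_zero_left)
    then have "countable ?C" by (intro countable_finite finite_imageI)
    moreover have "axis_thin n (?V B q \<inter> {x. inner x i = c})" if c: "c \<notin> ?C" for c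
    proof -
      define r where "r = q + (c - inner q i) *\<^sub>R i"
      have "f r \<noteq> 0"
      proof
        assume "f r = 0"
        then have "c - inner q i \<in> {t. f (q + t *\<^sub>R i) = 0}" by (simp add: r_def)
        then have "inner q i + (c - inner q i) \<in> ?C" by (rule imageI)
        with c show False by simp
      qed
      moreover have n: "n = card (B - {i})" using Suc.hyps(2) True fin by simp
      ultimately have "axis_thin n (?V (B - {i}) r)"
        using Suc.hyps(1)[of "B - {i}" r] Suc.prems(1) by auto
      moreover have "?V B q \<inter> {x. inner x i = c} \<subseteq> ?V (B - {i}) r"
        using i by (auto simp: r_def inner_add_left inner_Basis)
      ultimately show ?thesis by (rule axis_thin_subset)
    qed
    ultimately show ?thesis by blast
  next
    case False
    then have "?V B q \<inter> {x. inner x i = c} = {}" if "c \<notin> {inner q i}" for c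
      using i that by auto
    then have "\<forall>c. c \<notin> {inner q i} \<longrightarrow> axis_thin n (?V B q \<inter> {x. inner x i = c})"
      by (metis (no_types, lifting) axis_thin_empty)
    then show ?thesis by (intro exI[of _ "{inner q i}"]) simp
  qed
  then show ?case
    unfolding Suc.hyps(2)[symmetric] by (rule axis_thin_SucI)
qed

section \<open>Lower bounds for the dimension\<close>

lemma connected_subset_dim_le_0:
  fixes S :: "'a::t1_space set"
  assumes dim: "top_of_set S dim_le 0" and "T \<subseteq> S" "connected T" "x \<in> T" "y \<in> T"
  shows "x = y"
proof (rule ccontr)
  assume "x \<noteq> y"
  have "top_of_set T dim_le 0"
    using dimension_le_subtopologies[OF dim \<open>T \<subseteq> S\<close>] .
  \<comment> \<open>Zero-dimensionality yields a clopen neighbourhood of \<open>x\<close> inside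
    this set; it is neither empty nor all of the connected set \<open>T\<close>.\<close>
  moreover have "openin (top_of_set T) (T - {y})"
    by (metis Diff_eq closed_singleton open_Compl openin_open_Int)
  ultimately obtain U where U: "x \<in> U" "U \<subseteq> T - {y}" "closedin (top_of_set T) U" "openin (top_of_set T) U"
    using assms(4) \<open>x \<noteq> y\<close>
    unfolding dimension_le_0_neighbourhood_base_of_clopen
    by (auto simp: open_neighbourhood_base_of) (metis DiffI empty_iff insert_iff)
  then have "U = {} \<or> U = T"
    using assms(3) connected_clopen by blast
  with U assms(5) show False by auto
qed

text \<open>A small neighbourhood of \<open>p\<close> with zero-dimensional frontier would separate \<open>p\<close> from the outside of
  the ball; then a component of the frontier, that is a single point, would already do so.\<close>

lemma ball_not_dim_le_1:
  fixes p :: "'a::euclidean_space"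
  assumes "DIM('a) \<ge> 2" "r > 0"
  shows "\<not> top_of_set (ball p r) dim_le 1"
proof
  assume "top_of_set (ball p r) dim_le 1"
  moreover have "openin (top_of_set (ball p r)) (ball p (r / 2))"
    using \<open>r > 0\<close> by (auto simp: openin_open_eq)
  moreover have "p \<in> ball p (r / 2)" using \<open>r > 0\<close> by simp
  ultimately have "\<exists>U. p \<in> U \<and> U \<subseteq> ball p (r / 2) \<and> openin (top_of_set (ball p r)) U
      \<and> subtopology (top_of_set (ball p r)) (top_of_set (ball p r) frontier_of U) dim_le 1 - 1"
    unfolding dimension_le.simps[of "top_of_set (ball p r)" 1] by metis
  then obtain U where U: "p \<in> U" "U \<subseteq> ball p (r / 2)" "openin (top_of_set (ball p r)) U"
    "subtopology (top_of_set (ball p r)) (top_of_set (ball p r) frontier_of U) dim_le 0"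
    by auto
  have "open U" using U(3) openin_open_eq[of "ball p r" U] by auto
  \<comment> \<open>Halving the radius keeps the closure of \<open>U\<close> inside the open ball,
    so its frontier relative to the ball is its frontier in the whole space.\<close>
  have sub: "frontier U \<subseteq> ball p r"
  proof -
    have "closure U \<subseteq> cball p (r / 2)"
      using U(2) closure_minimal[of U "cball p (r / 2)"] by fastforce
    then show ?thesis using \<open>r > 0\<close> by (fastforce simp: frontier_def)
  qed
  have "top_of_set (ball p r) frontier_of U = frontier U"
    using sub U(3) frontier_of_subtopology_open[of euclidean "ball p r" U] by auto
  then have dim: "top_of_set (frontier U) dim_le 0"
    using U(4) sub by (simp add: subtopology_subtopology Int_absorb1)
  obtain q where q: "q \<notin> ball p r"
    using bounded_ball not_bounded_UNIV by (metis UNIV_eq_I)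
  have "\<not> connected_component (- frontier U) p q"
  proof
    assume "connected_component (- frontier U) p q"
    then obtain K where "connected K" "K \<subseteq> - frontier U" "p \<in> K" "q \<in> K"
      by (auto simp: connected_component_def)
    moreover have "q \<notin> U" using q U(2) \<open>r > 0\<close> by fastforce
    ultimately have "K \<inter> frontier U \<noteq> {}"
      using connected_Int_frontier[of K U] U(1) by blast
    with \<open>K \<subseteq> - frontier U\<close> show False by blast
  qed
  then obtain C where C: "C \<in> components (frontier U)" "\<not> connected_component (- C) p q"
    using separation_by_component_closed_pointwise[of "frontier U"] by auto
  have "C \<noteq> {}" "connected C" "C \<subseteq> frontier U"
    using C(1) in_components_nonempty in_components_connected in_components_subset by blast+
  then obtain c where c: "C = {c}"
    using connected_subset_dim_le_0[OF dim] by blast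
  have "c \<in> frontier U" using c \<open>C \<subseteq> frontier U\<close> by simp
  have "p \<noteq> c" using \<open>c \<in> frontier U\<close> \<open>open U\<close> U(1) by (auto simp: frontier_def interior_open)
  moreover have "q \<noteq> c" using \<open>c \<in> frontier U\<close> sub q by auto
  moreover have "connected (- {c})" using connected_punctured_universe[OF assms(1)] .
  ultimately have "connected_component (- C) p q"
    unfolding c connected_component_def by blast
  with C(2) show False by simp
qed

text \<open>By compactness \<open>h\<close> is a homeomorphism onto its image, and dimension is a
  topological invariant that is monotone under inclusion.\<close>

lemma not_dim_le_1_if_contains_disc:
  fixes h :: "'a::euclidean_space \<Rightarrow> 'b::t2_space"
  assumes "DIM('a) \<ge> 2" "r > 0" "continuous_on (cball p r) h" "inj_on h (cball p r)" "h ` cball p r \<subseteq> S"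
  shows "\<not> top_of_set S dim_le 1"
proof
  assume "top_of_set S dim_le 1"
  then have "top_of_set (h ` cball p r) dim_le 1"
    using assms(5) dimension_le_subtopologies by blast
  moreover obtain g where "homeomorphism (cball p r) (h ` cball p r) h g"
    using homeomorphism_compact[OF compact_cball assms(3) refl assms(4)] by blast
  then have "top_of_set (cball p r) homeomorphic_space top_of_set (h ` cball p r)"
    unfolding homeomorphism_def homeomorphic_space_def homeomorphic_maps_def
    by (intro exI[of _ h] exI[of _ g]) auto
  ultimately have "top_of_set (cball p r) dim_le 1"
    by (simp add: homeomorphic_space_dimension_le)
  then have "top_of_set (ball p r) dim_le 1"
    using ball_subset_cball dimension_le_subtopologies by blast
  with ball_not_dim_le_1[OF assms(1,2)] show False by blast
qed

section \<open>Continuous implicit functions\<close>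

text \<open>If the derivative is positive, \<open>f u\<close> is strictly increasing near
  \<open>y0\<close> and changes sign between \<open>y0 - d\<close> and \<open>y0 + d\<close> for all
  \<open>u\<close> near \<open>u0\<close>. Hence the compact zero set \<open>Z\<close> over a small
  ball projects bijectively onto this ball, and the inverse of the projection is continuous. A
  negative derivative is treated by passing to \<open>- f\<close>.\<close>

lemma implicit_zero_function:
  fixes f :: "'a::euclidean_space \<Rightarrow> real \<Rightarrow> real"
  assumes cont: "continuous_on UNIV (\<lambda>(u, y). f u y)"
    and cont': "continuous_on UNIV (\<lambda>(u, y). f' u y)"
    and deriv: "\<And>u y. (f u has_real_derivative f' u y) (at y)"
    and zero: "f u0 y0 = 0" and ne: "f' u0 y0 \<noteq> 0"
  obtains r g where "r > 0" "continuous_on (cball u0 r) g" "\<And>u. u \<in> cball u0 r \<Longrightarrow> f u (g u) = 0"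
proof -
  note concl = that
  have pos: thesis
    if cont: "continuous_on UNIV (\<lambda>(u, y). f u y)"
    and cont': "continuous_on UNIV (\<lambda>(u, y). f' u y)"
    and deriv: "\<And>u y. (f u has_real_derivative f' u y) (at y)"
    and zero: "f u0 y0 = 0" and ne: "f' u0 y0 > 0"
    and that: "\<And>r g. r > 0 \<Longrightarrow> continuous_on (cball u0 r) g \<Longrightarrow> (\<And>u. u \<in> cball u0 r \<Longrightarrow> f u (g u) = 0) \<Longrightarrow> thesis"
  for f f' :: "'a \<Rightarrow> real \<Rightarrow> real"
  proof -
    have opn: "open {x. (\<lambda>(u, y). f' u y) x > 0}"
      by (intro open_Collect_less cont' continuous_on_const)
    have "(u0, y0) \<in> {x. (\<lambda>(u, y). f' u y) x > 0}" using ne by simp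
    with opn obtain A B where AB: "open A" "open B" "u0 \<in> A" "y0 \<in> B" "A \<times> B \<subseteq> {x. (\<lambda>(u, y). f' u y) x > 0}"
      by (rule open_prod_elim) (simp add: mem_Times_iff)
    obtain d where d: "d > 0" "cball y0 d \<subseteq> B"
      using AB(2,4) open_contains_cball by blast
    have mono: "f u s < f u t" if "u \<in> A" "s \<in> cball y0 d" "t \<in> cball y0 d" "s < t" for u s t
    proof (rule DERIV_pos_imp_increasing[OF \<open>s < t\<close>])
      fix x assume "s \<le> x" "x \<le> t"
      then have "x \<in> cball y0 d" using that(2,3) unfolding mem_cball dist_real_def by linarith
      then have "(u, x) \<in> A \<times> B" using d(2) \<open>u \<in> A\<close> by blast
      then have "f' u x > 0" using AB(5) by auto
      then show "\<exists>y. (f u has_real_derivative y) (at x) \<and> 0 < y"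
        using deriv[of u x] by blast
    qed
    have c1: "continuous_on UNIV (\<lambda>u. f u y)" for y
      using continuous_on_compose2[OF cont, of UNIV "\<lambda>u. (u, y)"]
      by (simp add: continuous_on_Pair continuous_on_id)
    have c2: "continuous_on X (f u)" for X u
      by (rule DERIV_continuous_on[OF has_field_derivative_at_within[OF deriv]])
    have "f u0 (y0 - d) < 0" "f u0 (y0 + d) > 0"
      using mono[of u0 "y0 - d" y0] mono[of u0 y0 "y0 + d"] zero AB(3) d(1)
      by (auto simp: dist_real_def)
    moreover have "open (A \<inter> {u. f u (y0 - d) < 0} \<inter> {u. f u (y0 + d) > 0})"
      using AB(1) by (intro open_Int open_Collect_less c1 continuous_intros) auto
    ultimately obtain r where r: "r > 0" "cball u0 r \<subseteq> A \<inter> {u. f u (y0 - d) < 0} \<inter> {u. f u (y0 + d) > 0}"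
      using AB(3) open_contains_cball by blast
    define Z where "Z = (cball u0 r \<times> cball y0 d) \<inter> {x. (\<lambda>(u, y). f u y) x = 0}"
    have "compact Z"
      unfolding Z_def by (intro compact_Int_closed compact_Times compact_cball closed_Collect_eq cont continuous_intros)
    moreover have "fst ` Z = cball u0 r"
    proof (intro equalityI subsetI)
      fix u assume u: "u \<in> cball u0 r"
      then have "f u (y0 - d) \<le> 0" "0 \<le> f u (y0 + d)" using r(2) by (auto intro: less_imp_le)
      then obtain y where "y0 - d \<le> y" "y \<le> y0 + d" "f u y = 0"
        using IVT'[of "f u" "y0 - d" 0 "y0 + d"] d(1) c2 by auto
      then have "(u, y) \<in> Z" using u by (auto simp: Z_def dist_real_def)
      then show "u \<in> fst ` Z" by force
    qed (auto simp: Z_def)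
    moreover have "inj_on fst Z"
    proof (rule inj_onI)
      fix a b assume ab: "a \<in> Z" "b \<in> Z" "fst a = fst b"
      obtain u s t where "a = (u, s)" "b = (u, t)" using ab(3) by (cases a, cases b) auto
      then show "a = b"
        using mono[of u s t] mono[of u t s] ab r(2) by (force simp: Z_def)
    qed
    ultimately obtain g where "homeomorphism Z (cball u0 r) fst g"
      using homeomorphism_compact[of Z fst "cball u0 r"] continuous_on_fst[OF continuous_on_id] by blast
    then have g: "continuous_on (cball u0 r) g" "\<And>u. u \<in> cball u0 r \<Longrightarrow> g u \<in> Z \<and> fst (g u) = u"
      by (auto simp: homeomorphism_def)
    show thesis
    proof (rule that[OF r(1)])
      show "continuous_on (cball u0 r) (\<lambda>u. snd (g u))"
        by (intro continuous_intros g)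
      show "f u (snd (g u)) = 0" if "u \<in> cball u0 r" for u
        using g(2)[OF that] by (auto simp: Z_def case_prod_unfold)
    qed
  qed
  show thesis
  proof (cases "f' u0 y0 > 0")
    case True
    show thesis by (rule pos[OF cont cont' deriv zero True that])
  next
    case False
    have c: "continuous_on UNIV (\<lambda>(u, y). - f u y)"
      using continuous_on_minus[OF cont] by (simp add: case_prod_unfold)
    have c': "continuous_on UNIV (\<lambda>(u, y). - f' u y)"
      using continuous_on_minus[OF cont'] by (simp add: case_prod_unfold)
    show thesis
    proof (rule pos[OF c c'])
      show "((\<lambda>y. - f u y) has_real_derivative - f' u y) (at y)" for u y
        by (rule DERIV_minus[OF deriv])
      show "- f u0 y0 = 0" "- f' u0 y0 > 0"
        using False ne zero by simp_all
      show thesis if "r > 0" "continuous_on (cball u0 r) g" "\<And>u. u \<in> cball u0 r \<Longrightarrow> - f u (g u) = 0" for r g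
        by (rule concl[OF that(1,2)]) (use that(3) in simp)
    qed
  qed
qed

section \<open>Resultants, discriminants and square-free parts\<close>

lemma sum_coeff_power_eq_poly:
  fixes p :: "'a::comm_semiring_1 poly"
  assumes "degree p \<le> m"
  shows "(\<Sum>k\<le>m. coeff p k * x ^ k) = poly p x"
  unfolding poly_altdef
  by (rule sum.mono_neutral_right) (use assms in \<open>auto simp: coeff_eq_0\<close>)

text \<open>The rows are the coefficient vectors of the products of \<open>p\<close> and
  \<open>q\<close> with powers of the variable, so the vector of powers of \<open>x\<close>
  evaluates these products at a common root. Since \<open>m\<close> and \<open>n\<close> merely
  bound the degrees, this applies after a specialisation that lowers them.\<close>

lemma sylvester_mat_sub_mult_powers:
  fixes p q :: "'a::field poly"
  assumes "degree p \<le> m" "degree q \<le> n" "poly p x = 0" "poly q x = 0"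
  shows "sylvester_mat_sub m n p q *\<^sub>v vec (m + n) (\<lambda>j. x ^ (m + n - 1 - j)) = 0\<^sub>v (m + n)"
proof (rule eq_vecI)
  fix i assume "i < dim_vec (0\<^sub>v (m + n) :: 'a vec)"
  then have i: "i < m + n" by simp
  let ?S = "sylvester_mat_sub m n p q" and ?v = "vec (m + n) (\<lambda>j. x ^ (m + n - 1 - j))"
  have "(?S *\<^sub>v ?v) $ i = (\<Sum>j<m + n. ?S $$ (i, j) * x ^ (m + n - 1 - j))"
    using i by (simp add: scalar_prod_def atLeast0LessThan)
  also have "\<dots> = 0"
  proof (cases "i < n")
    case True
    have "(\<Sum>j<m + n. ?S $$ (i, j) * x ^ (m + n - 1 - j))
        = (\<Sum>j\<in>{i..i + m}. coeff p (m + i - j) * x ^ (m + n - 1 - j))"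
      using i True by (intro sum.mono_neutral_cong_right) (auto simp: sylvester_mat_sub_index)
    also have "\<dots> = (\<Sum>k\<le>m. coeff p k * x ^ (n - 1 - i + k))"
      by (rule sum.reindex_bij_witness[of _ "\<lambda>k. m + i - k" "\<lambda>j. m + i - j"])
        (use True in \<open>auto intro!: arg_cong[of _ _ "\<lambda>e. x ^ e"]\<close>)
    also have "\<dots> = x ^ (n - 1 - i) * (\<Sum>k\<le>m. coeff p k * x ^ k)"
      by (simp add: sum_distrib_left power_add mult_ac)
    finally show ?thesis using assms by (simp add: sum_coeff_power_eq_poly)
  next
    case False
    have "(\<Sum>j<m + n. ?S $$ (i, j) * x ^ (m + n - 1 - j))
        = (\<Sum>j\<in>{i - n..i}. coeff q (i - j) * x ^ (m + n - 1 - j))"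
      using i False by (intro sum.mono_neutral_cong_right) (auto simp: sylvester_mat_sub_index)
    also have "\<dots> = (\<Sum>k\<le>n. coeff q k * x ^ (m + n - 1 - i + k))"
      by (rule sum.reindex_bij_witness[of _ "\<lambda>k. i - k" "\<lambda>j. i - j"])
        (use i False in \<open>auto intro!: arg_cong[of _ _ "\<lambda>e. x ^ e"]\<close>)
    also have "\<dots> = x ^ (m + n - 1 - i) * (\<Sum>k\<le>n. coeff q k * x ^ k)"
      by (simp add: sum_distrib_left power_add mult_ac)
    finally show ?thesis using assms by (simp add: sum_coeff_power_eq_poly)
  qed
  finally show "(?S *\<^sub>v ?v) $ i = 0\<^sub>v (m + n) $ i" using i by simp
qed simp

text \<open>The only entries of the first column that can be nonzero are the formal leading
  coefficients \<open>coeff p m\<close> and \<open>coeff q n\<close>.\<close>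

lemma sylvester_mat_sub_mult_unit_vec:
  fixes p q :: "'a::field poly"
  assumes "coeff p m = 0" "coeff q n = 0" "m + n > 0"
  shows "sylvester_mat_sub m n p q *\<^sub>v unit_vec (m + n) 0 = 0\<^sub>v (m + n)"
proof (rule eq_vecI)
  fix i assume "i < dim_vec (0\<^sub>v (m + n) :: 'a vec)"
  then have i: "i < m + n" by simp
  have "sylvester_mat_sub m n p q $$ (i, 0) = 0"
    using assms i by (auto simp: sylvester_mat_sub_index)
  then show "(sylvester_mat_sub m n p q *\<^sub>v unit_vec (m + n) 0) $ i = 0\<^sub>v (m + n) $ i"
    using i assms(3) by simp
qed simp

text \<open>The homomorphism may lower the degrees, so the image of the resultant need not be a resultant.\<close>

context comm_ring_hom
begin

lemma hom_resultant_eq_det: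
  "hom (resultant p q) = det (sylvester_mat_sub (degree p) (degree q) (map_poly hom p) (map_poly hom q))"
  by (simp add: resultant_def sylvester_mat_def sylvester_mat_sub_map flip: hom_det)

end

lemma hom_resultant_eq_0_if_common_root:
  fixes hom :: "'a::comm_ring_1 \<Rightarrow> 'b::field"
  assumes "comm_ring_hom hom" and "poly (map_poly hom p) x = 0" "poly (map_poly hom q) x = 0"
    and "degree p + degree q > 0"
  shows "hom (resultant p q) = 0"
proof -
  interpret comm_ring_hom hom by fact
  let ?m = "degree p" and ?n = "degree q"
  let ?v = "vec (?m + ?n) (\<lambda>j. x ^ (?m + ?n - 1 - j))"
  \<comment> \<open>The last entry of the vector is \<open>x ^ 0 = 1\<close>, also when
    \<open>x = 0\<close>.\<close>
  have "?v $ (?m + ?n - 1) \<noteq> 0\<^sub>v (?m + ?n) $ (?m + ?n - 1)" using assms(4) by simp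
  then have "?v \<noteq> 0\<^sub>v (?m + ?n)" by metis
  moreover have "sylvester_mat_sub ?m ?n (map_poly hom p) (map_poly hom q) *\<^sub>v ?v = 0\<^sub>v (?m + ?n)"
    using assms(2,3) by (intro sylvester_mat_sub_mult_powers degree_map_poly_le)
  ultimately show ?thesis
    unfolding hom_resultant_eq_det det_0_iff_vec_prod_zero_field[OF sylvester_mat_sub_carrier]
    by (intro exI[of _ ?v]) simp
qed

text \<open>Applied to \<open>F\<close> and its derivative, this shows that the leading coefficient
  of \<open>F\<close> cannot vanish where the discriminant does not.\<close>

lemma hom_resultant_eq_0_if_lead_coeffs:
  fixes hom :: "'a::comm_ring_1 \<Rightarrow> 'b::field"
  assumes "comm_ring_hom hom" and "hom (lead_coeff p) = 0" "hom (lead_coeff q) = 0"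
    and "degree p + degree q > 0"
  shows "hom (resultant p q) = 0"
proof -
  interpret comm_ring_hom hom by fact
  let ?m = "degree p" and ?n = "degree q"
  let ?v = "unit_vec (?m + ?n) 0 :: 'b vec"
  have "?v $ 0 \<noteq> 0\<^sub>v (?m + ?n) $ 0" using assms(4) by simp
  then have "?v \<noteq> 0\<^sub>v (?m + ?n)" by metis
  moreover have "sylvester_mat_sub ?m ?n (map_poly hom p) (map_poly hom q) *\<^sub>v ?v = 0\<^sub>v (?m + ?n)"
    using assms by (intro sylvester_mat_sub_mult_unit_vec) simp_all
  ultimately show ?thesis
    unfolding hom_resultant_eq_det det_0_iff_vec_prod_zero_field[OF sylvester_mat_sub_carrier]
    by (intro exI[of _ ?v]) simp
qed

section \<open>Discriminants of square-free polynomials\<close>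

lemma prime_factor_of_positive_degree:
  fixes g :: "'a::{factorial_ring_gcd,semiring_gcd_mult_normalize} poly"
  shows "degree g > 0 \<Longrightarrow> \<exists>p. prime p \<and> degree p > 0 \<and> p dvd g"
proof (induction g rule: prime_divisors_induct)
  case (factor p g)
  show ?case
  proof (cases "degree p > 0")
    case True
    with factor show ?thesis by auto
  next
    case False
    then have "degree g > 0"
      using factor(3) degree_mult_le[of p g] by simp
    with factor show ?thesis by (metis dvd_mult)
  qed
qed (auto simp: is_unit_poly_iff)

text \<open>A zero resultant gives \<open>g\<close> and its derivative a common prime factor
  \<open>p\<close> of positive degree. With \<open>g = p * k\<close> the product rule yields
  \<open>p dvd pderiv p * k\<close>. In characteristic 0 the derivative of \<open>p\<close> is
  nonzero of smaller degree, so \<open>p\<close> divides \<open>k\<close> and its square divides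
  \<open>g\<close>.\<close>

lemma disc_res_nonzero_if_squarefree:
  fixes g :: "'a::{factorial_ring_gcd,semiring_gcd_mult_normalize,ring_char_0} poly"
  assumes "squarefree g" "degree g > 0"
  shows "disc_res g \<noteq> 0"
proof
  assume "disc_res g = 0"
  then have "degree (gcd g (pderiv g)) > 0"
    by (simp add: disc_res_def resultant_0_gcd)
  then obtain p where p: "prime p" "degree p > 0" "p dvd gcd g (pderiv g)"
    using prime_factor_of_positive_degree by blast
  then obtain k where k: "g = p * k" "p dvd pderiv g" by auto
  then have "p dvd pderiv p * k"
    by (metis dvd_add_right_iff dvd_triv_left pderiv_mult mult.commute)
  moreover have "\<not> p dvd pderiv p"
    using p(2) dvd_imp_degree_le[of p "pderiv p"] by (auto simp: degree_pderiv pderiv_eq_0_iff)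
  ultimately have "p dvd k" using p(1) prime_dvd_mult_iff by blast
  then have "p\<^sup>2 dvd g" using k(1) by (auto simp: power2_eq_square)
  then have "is_unit p" using assms(1) by (simp add: squarefree_def)
  with p(1) show False by auto
qed

lemma squarefree_sqfree_part:
  assumes "G \<noteq> 0"
  shows "squarefree (sqfree_part G)"
proof -
  have "squarefree (\<Prod>(prime_factors G))"
    by (rule squarefree_prod_coprime)
      (auto intro: primes_coprime squarefree_prime in_prime_factors_imp_prime)
  with assms show ?thesis by (simp add: sqfree_part_def)
qed

lemma sqfree_part_nonzero: "G \<noteq> 0 \<Longrightarrow> sqfree_part G \<noteq> 0"
  by (auto simp: sqfree_part_def)

text \<open>Units have nonzero image and the target has no zero divisors, so a zero comes from a
  prime factor. With evaluation at a point as \<open>hom\<close>, this passes from the zeros of a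
  discriminant to those of its prime factors.\<close>

lemma zero_imp_prime_factor_zero:
  fixes hom :: "'a::factorial_semiring \<Rightarrow> 'b::semidom"
  assumes "\<And>a b. hom (a * b) = hom a * hom b" "hom 1 = 1"
  shows "G \<noteq> 0 \<Longrightarrow> hom G = 0 \<Longrightarrow> \<exists>p\<in>prime_factors G. hom p = 0"
proof (induction G rule: prime_divisors_induct)
  case (unit x)
  then show ?case
    by (metis assms dvdE mult_eq_0_iff mult_zero_left zero_neq_one)
next
  case (factor p x)
  then have nz: "x \<noteq> 0" "p \<noteq> 0" by auto
  then have "prime_factors (p * x) = insert p (prime_factors x)"
    using factor(1) by (simp add: prime_factorization_mult prime_factorization_prime)
  with factor nz assms show ?case by auto
qed simp

section \<open>Polynomial functions in two and three variables\<close>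

definition eval_xz :: "real poly poly \<Rightarrow> real \<Rightarrow> real \<Rightarrow> real" where
  "eval_xz q x z = poly (poly q [:x:]) z"

lemma eval_xz_simps [simp]:
  "eval_xz 0 x z = 0" "eval_xz 1 x z = 1" "eval_xz (p + q) x z = eval_xz p x z + eval_xz q x z"
  "eval_xz (p * q) x z = eval_xz p x z * eval_xz q x z"
  "eval_xz [:a:] x z = poly a z"
  by (simp_all add: eval_xz_def)

lemma comm_ring_hom_eval_xz: "comm_ring_hom (\<lambda>q. eval_xz q x z)"
  by unfold_locales (simp_all add: eval_xz_def)

lemma comm_ring_hom_poly: "comm_ring_hom (\<lambda>p. poly p z)"
  by (rule poly_hom.comm_ring_hom_axioms)

lemma eval_xyz_eq_eval_xz: "eval_xyz F x y z = eval_xz (poly F [:[:y:]:]) x z"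
  by (simp add: eval_xyz_def eval_xz_def)

text \<open>Specialising the coefficients first leaves a univariate polynomial in the outermost
  variable, to which root counting, differentiation and resultants apply.\<close>

lemma eval_xz_eq_poly: "eval_xz q x z = poly (map_poly (\<lambda>p. poly p z) q) x"
  using poly_hom.poly_map_poly[of z q "[:x:]"] by (simp add: eval_xz_def)

lemma eval_xyz_eq_poly: "eval_xyz F x y z = poly (map_poly (\<lambda>q. eval_xz q x z) F) y"
proof -
  interpret comm_ring_hom "\<lambda>q. eval_xz q x z" by (rule comm_ring_hom_eval_xz)
  show ?thesis using poly_map_poly[of F "[:[:y:]:]"] by (simp add: eval_xyz_eq_eval_xz)
qed

lemma map_poly_pderiv_comm_ring_hom:
  fixes hom :: "'a::idom \<Rightarrow> 'b::idom"
  assumes "comm_ring_hom hom"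
  shows "map_poly hom (pderiv p) = pderiv (map_poly hom p)"
proof -
  interpret comm_ring_hom hom by fact
  interpret idom_hom hom ..
  show ?thesis by (rule map_poly_pderiv)
qed

lemma eval_xyz_has_derivative_y:
  "((\<lambda>y. eval_xyz F x y z) has_real_derivative eval_xyz (pderiv F) x y z) (at y)"
  unfolding eval_xyz_eq_poly map_poly_pderiv_comm_ring_hom[OF comm_ring_hom_eval_xz]
  by (rule poly_DERIV)

lemma eval_xz_has_derivative_x:
  "((\<lambda>x. eval_xz q x z) has_real_derivative eval_xz (pderiv q) x z) (at x)"
  unfolding eval_xz_eq_poly map_poly_pderiv_comm_ring_hom[OF comm_ring_hom_poly]
  by (rule poly_DERIV)

lemma continuous_on_eval_xz [continuous_intros]:
  assumes "continuous_on S f" "continuous_on S g"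
  shows "continuous_on S (\<lambda>t. eval_xz q (f t) (g t))"
proof (induction q)
  case (pCons a q)
  have "eval_xz (pCons a q) x z = poly a z + x * eval_xz q x z" for x z
    by (simp add: eval_xz_def)
  then show ?case using pCons.IH assms by (auto intro!: continuous_intros)
qed simp

lemma continuous_on_eval_xyz [continuous_intros]:
  assumes "continuous_on S f" "continuous_on S g" "continuous_on S h"
  shows "continuous_on S (\<lambda>t. eval_xyz F (f t) (g t) (h t))"
proof (induction F)
  case (pCons a F)
  have "eval_xyz (pCons a F) x y z = eval_xz a x z + y * eval_xyz F x y z" for x y z
    by (simp add: eval_xyz_def eval_xz_def)
  then show ?case using pCons.IH assms by (auto intro!: continuous_intros)
qed (simp add: eval_xyz_def)

lemma finite_zeros_or_zero: "finite {t. poly p t = 0} \<or> (\<forall>t. poly p t = 0)"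
  for p :: "real poly"
  by (cases "p = 0") (auto intro: poly_roots_finite)

lemma finite_zeros_eval_xz_x: "finite {x. eval_xz q x z = 0} \<or> (\<forall>x. eval_xz q x z = 0)"
  unfolding eval_xz_eq_poly by (rule finite_zeros_or_zero)

lemma finite_zeros_eval_xz_z: "finite {z. eval_xz q x z = 0} \<or> (\<forall>z. eval_xz q x z = 0)"
  unfolding eval_xz_def by (rule finite_zeros_or_zero)

lemma finite_zeros_eval_xyz_x: "finite {x. eval_xyz F x y z = 0} \<or> (\<forall>x. eval_xyz F x y z = 0)"
  unfolding eval_xyz_eq_eval_xz by (rule finite_zeros_eval_xz_x)

lemma finite_zeros_eval_xyz_y: "finite {y. eval_xyz F x y z = 0} \<or> (\<forall>y. eval_xyz F x y z = 0)"
  unfolding eval_xyz_eq_poly by (rule finite_zeros_or_zero)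

lemma finite_zeros_eval_xyz_z: "finite {z. eval_xyz F x y z = 0} \<or> (\<forall>z. eval_xyz F x y z = 0)"
  unfolding eval_xyz_eq_eval_xz by (rule finite_zeros_eval_xz_z)

section \<open>Vanishing on lines and planes, and finiteness of common zeros\<close>

lemma poly_eq_0_if_zero_on_constants:
  fixes p :: "'a::{idom,ring_char_0} poly"
  assumes "inj c" "\<And>x::real. poly p (c x) = 0"
  shows "p = 0"
proof (rule ccontr)
  assume "p \<noteq> 0"
  then have "finite (range c)"
    using assms(2) by (intro finite_subset[OF _ poly_roots_finite[of p]]) auto
  with assms(1) show False using finite_imageD infinite_UNIV_char_0 by blast
qed

lemma finite_vanishing_x: "q \<noteq> 0 \<Longrightarrow> finite {x. \<forall>z. eval_xz q x z = 0}"
proof -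
  assume "q \<noteq> 0"
  have "poly q [:x:] = 0" if "\<forall>z. eval_xz q x z = 0" for x
    using that by (simp add: eval_xz_def poly_all_0_iff_0)
  then have "(\<lambda>x. [:x:]) ` {x. \<forall>z. eval_xz q x z = 0} \<subseteq> {r. poly q r = 0}" by auto
  then have "finite ((\<lambda>x. [:x:]) ` {x. \<forall>z. eval_xz q x z = 0})"
    using poly_roots_finite[OF \<open>q \<noteq> 0\<close>] finite_subset by blast
  then show ?thesis by (rule finite_imageD) (simp add: inj_on_def)
qed

lemma vanishing_z_iff: "(\<forall>x. eval_xz q x a = 0) \<longleftrightarrow> (\<forall>n. poly (coeff q n) a = 0)"
proof -
  have "(\<forall>x. eval_xz q x a = 0) \<longleftrightarrow> map_poly (\<lambda>p. poly p a) q = 0"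
    by (simp add: eval_xz_eq_poly poly_all_0_iff_0)
  also have "\<dots> \<longleftrightarrow> (\<forall>n. poly (coeff q n) a = 0)"
    by (simp add: poly_eq_iff coeff_map_poly)
  finally show ?thesis .
qed

lemma vanishing_z_iff_dvd: "(\<forall>x. eval_xz q x a = 0) \<longleftrightarrow> [:[:- a, 1:]:] dvd q"
  by (simp add: vanishing_z_iff const_poly_dvd_iff poly_eq_0_iff_dvd)

lemma finite_vanishing_z:
  assumes "q \<noteq> 0"
  shows "finite {z. \<forall>x. eval_xz q x z = 0}"
proof (rule finite_subset)
  show "{z. \<forall>x. eval_xz q x z = 0} \<subseteq> {z. poly (lead_coeff q) z = 0}"
    by (auto simp: vanishing_z_iff)
  show "finite {z. poly (lead_coeff q) z = 0}"
    using assms by (intro poly_roots_finite) simp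
qed

text \<open>If the plane \<open>z = a\<close> lies in the surface, every coefficient with respect to
  \<open>y\<close> vanishes on it and is divisible by \<open>z - a\<close>. Without factors in
  \<open>z\<close> alone, no level is a full plane.\<close>

lemma vanishing_level_imp_dvd:
  assumes "\<And>x y. eval_xyz F x y a = 0"
  shows "[:[:[:- a, 1:]:]:] dvd F"
proof -
  have "eval_xz (coeff F n) x a = 0" for n x
  proof -
    interpret comm_ring_hom "\<lambda>q. eval_xz q x a" by (rule comm_ring_hom_eval_xz)
    have "map_poly (\<lambda>q. eval_xz q x a) F = 0"
      using assms[of x] by (subst poly_all_0_iff_0[symmetric]) (simp add: eval_xyz_eq_poly)
    then show ?thesis by (metis coeff_0 coeff_map_poly_hom)
  qed
  then show ?thesis
    unfolding const_poly_dvd_iff[of "[:[:- a, 1:]:]" F] vanishing_z_iff_dvd[symmetric] by blast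
qed

text \<open>The \<open>z\<close>-coordinates of common zeros are roots of the nonzero resultant, or
  of \<open>P\<close> itself if \<open>P\<close> depends only on \<open>z\<close>. A level with
  infinitely many common zeros would make \<open>z\<close> minus a constant divide both polynomials;
  it would be associated to the prime \<open>P\<close>, which would then divide
  \<open>G\<close>.\<close>

lemma finite_common_zeros:
  assumes P: "prime P" "\<not> P dvd G"
  shows "finite {(x, z). eval_xz P x z = 0 \<and> eval_xz G x z = 0}"
proof -
  have "P \<noteq> 0" using P(1) by auto
  define Z where "Z = {z. \<exists>x. eval_xz P x z = 0 \<and> eval_xz G x z = 0}"
  have "finite Z"
  proof (cases "degree P = 0")
    case True
    then obtain p where p: "P = [:p:]" by (rule degree_eq_zeroE)
    then have "Z \<subseteq> {z. poly p z = 0}" by (auto simp: Z_def)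
    moreover have "p \<noteq> 0" using \<open>P \<noteq> 0\<close> p by auto
    ultimately show ?thesis using poly_roots_finite finite_subset by blast
  next
    case False
    have "resultant P G \<noteq> 0"
    proof
      assume "resultant P G = 0"
      then have "degree (gcd P G) \<noteq> 0" by (simp add: resultant_0_gcd)
      then have "\<not> is_unit (gcd P G)" by (auto simp: is_unit_poly_iff)
      then have "\<not> coprime P G" by (simp add: coprime_iff_gcd_eq_1)
      then show False using P prime_imp_coprime by blast
    qed
    moreover have "poly (resultant P G) z = 0" if "eval_xz P x z = 0" "eval_xz G x z = 0" for x z
      using that False
      by (intro hom_resultant_eq_0_if_common_root[OF comm_ring_hom_poly, of _ _ x])
        (simp_all add: eval_xz_eq_poly)
    then have "Z \<subseteq> {z. poly (resultant P G) z = 0}" by (auto simp: Z_def)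
    ultimately show ?thesis using poly_roots_finite finite_subset by blast
  qed
  moreover have "finite {x. eval_xz P x z = 0 \<and> eval_xz G x z = 0}" for z
  proof (rule ccontr)
    assume inf: "infinite {x. eval_xz P x z = 0 \<and> eval_xz G x z = 0}"
    have "\<forall>x. eval_xz P x z = 0"
      using finite_zeros_eval_xz_x[of P z] inf by (auto elim: finite_subset[rotated])
    moreover have "\<forall>x. eval_xz G x z = 0"
      using finite_zeros_eval_xz_x[of G z] inf by (auto elim: finite_subset[rotated])
    ultimately have dvd: "[:[:- z, 1:]:] dvd P" "[:[:- z, 1:]:] dvd G"
      by (simp_all add: vanishing_z_iff_dvd)
    moreover have "\<not> is_unit [:[:- z, 1:]:]"
      by (simp add: is_unit_poly_iff)
    ultimately have "P dvd [:[:- z, 1:]:]"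
      using P(1) by (metis irreducibleD' prime_elem_imp_irreducible prime_imp_prime_elem)
    with dvd(2) P(2) show False using dvd_trans by blast
  qed
  ultimately have "finite (\<Union>z\<in>Z. (\<lambda>x. (x, z)) ` {x. eval_xz P x z = 0 \<and> eval_xz G x z = 0})"
    by auto
  then show ?thesis by (rule rev_finite_subset) (auto simp: Z_def)
qed

text \<open>Induction on the degree by splitting off one value:
  \<open>F = P * k + (y - c0) * H\<close>. For \<open>c \<noteq> c0\<close> the constant
  \<open>c - c0\<close> is a unit, so \<open>P\<close> still divides the value of \<open>H\<close>
  at infinitely many \<open>c\<close>.\<close>

lemma const_dvd_if_dvd_infinitely_many_values:
  fixes F :: "real poly poly poly"
  assumes "infinite {c. P dvd poly F [:[:c:]:]}"
  shows "[:P:] dvd F"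
  using assms
proof (induction "degree F" arbitrary: F rule: less_induct)
  case less
  show ?case
  proof (cases "degree F = 0")
    case True
    then obtain f where "F = [:f:]" by (rule degree_eq_zeroE)
    with less.prems show ?thesis
      by (cases "P dvd f") (auto simp: const_poly_dvd_iff coeff_pCons split: nat.splits)
  next
    case False
    obtain c0 k where k: "poly F [:[:c0:]:] = P * k"
      using not_finite_existsD[OF less.prems] by (auto elim: dvdE)
    then have "poly (F - [:P * k:]) [:[:c0:]:] = 0" by simp
    then obtain H where "F - [:P * k:] = [:- [:[:c0:]:], 1:] * H"
      unfolding poly_eq_0_iff_dvd by (elim dvdE)
    then have F: "F = [:P * k:] + [:- [:[:c0:]:], 1:] * H" by (simp add: algebra_simps)
    have "degree H < degree F"
    proof (cases "H = 0")
      case False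
      have "degree ([:- [:[:c0:]:], 1:] * H) = Suc (degree H)"
        using False by (subst degree_mult_eq) auto
      then show ?thesis
        by (subst F) (simp add: degree_add_eq_right)
    qed (use \<open>degree F \<noteq> 0\<close> in simp)
    moreover have "{c. P dvd poly F [:[:c:]:]} - {c0} \<subseteq> {c. P dvd poly H [:[:c:]:]}"
    proof safe
      fix c assume c: "P dvd poly F [:[:c:]:]" "c \<noteq> c0"
      have "poly F [:[:c:]:] = P * k + [:[:c - c0:]:] * poly H [:[:c:]:]"
        by (subst F) (simp add: algebra_simps flip: smult_add_left)
      then have "P dvd [:[:c - c0:]:] * poly H [:[:c:]:]"
        using c(1) by (simp add: dvd_add_right_iff)
      moreover have "is_unit [:[:c - c0:]:]" using c(2) by (simp add: is_unit_poly_iff)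
      ultimately show "P dvd poly H [:[:c:]:]"
        by (metis dvd_mult_unit_iff' mult.commute)
    qed
    then have "infinite {c. P dvd poly H [:[:c:]:]}"
      using less.prems by (meson finite_subset infinite_remove)
    ultimately have "[:P:] dvd H" by (rule less.hyps)
    moreover have "[:P:] dvd [:P * k:]" by (simp add: const_poly_dvd_iff coeff_pCons split: nat.splits)
    ultimately show ?thesis by (subst F) (intro dvd_add dvd_mult)
  qed
qed

section \<open>Surfaces and their level curves\<close>

lemma finite_zeros_shift:
  fixes g :: "real \<Rightarrow> real"
  assumes "finite {t. g t = 0} \<or> (\<forall>t. g t = 0)"
  shows "finite {t. g (a + t) = 0} \<or> (\<forall>t. g (a + t) = 0)"
  using assms
proof
  assume "finite {t. g t = 0}"
  then have "finite ((+) a -` {t. g t = 0})" by (rule finite_vimageI) simp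
  then show ?thesis by (simp add: vimage_def)
qed simp

lemma Basis_real2: "(Basis :: (real \<times> real) set) = {(1, 0), (0, 1)}"
  by (auto simp: Basis_prod_def)

lemma Basis_real3: "(Basis :: (real \<times> real \<times> real) set) = {(1, 0, 0), (0, 1, 0), (0, 0, 1)}"
  by (auto simp: Basis_prod_def zero_prod_def)

lemma axis_thin_surface:
  assumes "F \<noteq> 0"
  shows "axis_thin 3 (real_surface_points F)"
proof -
  let ?f = "\<lambda>(x, y, z). eval_xyz F x y z"
  have "\<exists>x y z. eval_xyz F x y z \<noteq> 0"
  proof (rule ccontr)
    assume "\<not> ?thesis"
    then have "poly F [:[:y:]:] = 0" for y
      using finite_vanishing_x[of "poly F [:[:y:]:]"] by (auto simp: eval_xyz_eq_eval_xz infinite_UNIV_char_0)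
    then have "F = 0" by (intro poly_eq_0_if_zero_on_constants[of "\<lambda>y. [:[:y:]:]"]) (auto simp: inj_def)
    with assms show False by simp
  qed
  then obtain q where q: "?f q \<noteq> 0" by auto
  have "axis_thin (card (Basis :: (real \<times> real \<times> real) set)) {p. ?f p = 0 \<and> (\<forall>i\<in>Basis - Basis. inner p i = inner q i)}"
  proof (rule axis_thin_zero_set[of ?f, OF _ subset_refl q])
    fix p i :: "real \<times> real \<times> real" assume "i \<in> Basis"
    then show "finite {t. ?f (p + t *\<^sub>R i) = 0} \<or> (\<forall>t. ?f (p + t *\<^sub>R i) = 0)"
      using finite_zeros_shift[OF finite_zeros_eval_xyz_x[of F "fst (snd p)" "snd (snd p)"], of "fst p"]
        finite_zeros_shift[OF finite_zeros_eval_xyz_y[of F "fst p" "snd (snd p)"], of "fst (snd p)"]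
        finite_zeros_shift[OF finite_zeros_eval_xyz_z[of F "fst p" "fst (snd p)"], of "snd (snd p)"]
      by (auto simp: Basis_real3 case_prod_unfold)
  qed
  then show ?thesis
    by (simp add: real_surface_points_def case_prod_unfold eval_nat_numeral)
qed

lemma axis_thin_level:
  assumes "\<not> [:[:[:- a, 1:]:]:] dvd F"
  shows "axis_thin 2 (real_level_points F a)"
proof -
  let ?f = "\<lambda>(x, y). eval_xyz F x y a"
  obtain x y where "eval_xyz F x y a \<noteq> 0" using assms vanishing_level_imp_dvd by blast
  then have q: "?f (x, y) \<noteq> 0" by simp
  have "axis_thin (card (Basis :: (real \<times> real) set)) {p. ?f p = 0 \<and> (\<forall>i\<in>Basis - Basis. inner p i = inner (x, y) i)}"
  proof (rule axis_thin_zero_set[of ?f, OF _ subset_refl q])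
    fix p i :: "real \<times> real" assume "i \<in> Basis"
    then show "finite {t. ?f (p + t *\<^sub>R i) = 0} \<or> (\<forall>t. ?f (p + t *\<^sub>R i) = 0)"
      using finite_zeros_shift[OF finite_zeros_eval_xyz_x[of F "snd p" a], of "fst p"]
        finite_zeros_shift[OF finite_zeros_eval_xyz_y[of F "fst p" a], of "snd p"]
      by (auto simp: Basis_real2 case_prod_unfold)
  qed
  then show ?thesis
    by (simp add: real_level_points_def case_prod_unfold eval_nat_numeral)
qed

lemma finite_exceptions:
  assumes "finite X" "\<And>c. c \<notin> X \<Longrightarrow> finite (S c)"
  shows "finite {c. infinite (S c)}"
  using assms(1) by (rule rev_finite_subset) (use assms(2) in blast)

lemma axis_thin_2_real3I:
  fixes T :: "(real \<times> real \<times> real) set"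
  assumes "finite {c. infinite (T \<inter> {(x, y, z). x = c})}"
    and "finite {c. infinite (T \<inter> {(x, y, z). y = c})}"
    and "finite {c. infinite (T \<inter> {(x, y, z). z = c})}"
  shows "axis_thin 2 T"
proof -
  have "axis_thin (Suc 1) T"
  proof (rule axis_thin_SucI)
    fix i :: "real \<times> real \<times> real" assume "i \<in> Basis"
    then have "finite {c. infinite (T \<inter> {p. inner p i = c})}"
      using assms by (auto simp: Basis_real3 case_prod_unfold inner_prod_def)
    moreover have "axis_thin 1 (T \<inter> {p. inner p i = c})" if "c \<notin> {c. infinite (T \<inter> {p. inner p i = c})}" for c
      using that by (intro countable_imp_axis_thin countable_finite) simp
    ultimately show "\<exists>C. countable C \<and> (\<forall>c. c \<notin> C \<longrightarrow> axis_thin 1 (T \<inter> {p. inner p i = c}))"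
      by (intro exI[of _ "{c. infinite (T \<inter> {p. inner p i = c})}"] conjI countable_finite allI impI)
  qed
  then show ?thesis by (simp add: numeral_2_eq_2)
qed

section \<open>Dimension of the surface and of its levels\<close>

locale surface_polynomial =
  fixes F :: "real poly poly poly"
  assumes sqf: "squarefree F"
    and no_z_factor: "\<And>p :: real poly. degree p > 0 \<Longrightarrow> \<not> [:[:p:]:] dvd F"
begin

lemma F_nonzero: "F \<noteq> 0"
  using sqf by auto

lemma level_dim_le_1: "top_of_set (real_level_points F a) dim_le 1"
  using axis_thin_imp_dim_le[OF axis_thin_level[of a F]] no_z_factor[of "[:- a, 1:]"] by simp

lemma surface_dim_le_2: "top_of_set (real_surface_points F) dim_le 2"
  using axis_thin_imp_dim_le[OF axis_thin_surface[OF F_nonzero]] by simp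

lemma surface_real_iff: "surface_real F \<longleftrightarrow> \<not> top_of_set (real_surface_points F) dim_le 1"
  using surface_dim_le_2 by (simp add: surface_real_def has_dimension_def)

lemma level_curve_real_iff: "level_curve_real F a \<longleftrightarrow> \<not> top_of_set (real_level_points F a) dim_le 0"
  using level_dim_le_1 by (simp add: level_curve_real_def has_dimension_def)

lemma infinite_level_if_real: "level_curve_real F a \<Longrightarrow> infinite (real_level_points F a)"
  using axis_thin_imp_dim_le[OF countable_imp_axis_thin[OF countable_finite]]
  by (auto simp: level_curve_real_iff)

lemma level_real_if_contains_curve:
  fixes c :: "real \<Rightarrow> real \<times> real"
  assumes "continuous_on {s..t} c" "\<And>u. u \<in> {s..t} \<Longrightarrow> c u \<in> real_level_points F a" "s \<le> t" "c s \<noteq> c t"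
  shows "level_curve_real F a"
proof -
  have conn: "connected (c ` {s..t})" using assms(1) by (intro connected_continuous_image) auto
  have sub: "c ` {s..t} \<subseteq> real_level_points F a" using assms(2) by blast
  have "c s = c t" if "top_of_set (real_level_points F a) dim_le 0"
    by (rule connected_subset_dim_le_0[OF that sub conn]) (use assms(3) in auto)
  with assms(4) show ?thesis by (auto simp: level_curve_real_iff)
qed

text \<open>A factor free of \<open>y\<close> divides the leading coefficient, which is free of
  \<open>x\<close>; it would therefore depend only on \<open>z\<close>.\<close>

lemma const_not_dvd_if_prime:
  assumes "degree F > 0" "degree (lead_coeff F) = 0" "prime P"
  shows "\<not> [:P:] dvd F"
proof
  assume dvd: "[:P:] dvd F"
  then have "P dvd lead_coeff F" by (simp add: const_poly_dvd_iff)
  then have "degree P = 0"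
    using dvd_imp_degree_le[of P "lead_coeff F"] assms(2) F_nonzero by simp
  then obtain p where p: "P = [:p:]" by (rule degree_eq_zeroE)
  have "\<not> is_unit P" "P \<noteq> 0" using assms(3) by auto
  then have "degree p > 0"
    using p by (auto simp: is_unit_poly_iff elim!: degree_eq_zeroE intro!: Nat.gr0I)
  with no_z_factor dvd p show False by blast
qed

text \<open>For each of the three coordinate directions, all but finitely many slices of this set
  are finite.\<close>

lemma axis_thin_critical_part:
  assumes deg: "degree F > 0" "degree (lead_coeff F) = 0" and "D \<noteq> 0"
  shows "axis_thin 2 {(x, y, z). eval_xyz F x y z = 0 \<and> eval_xz D x z = 0}"
proof -
  let ?C = "{(x, y, z). eval_xyz F x y z = 0 \<and> eval_xz D x z = 0}"
  obtain l where l: "lead_coeff F = [:l:]" using deg(2) by (rule degree_eq_zeroE)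
  have "l \<noteq> 0" using l F_nonzero by (metis leading_coeff_0_iff pCons_0_0)
  have fibre: "finite {y. eval_xyz F x y z = 0}" if "poly l z \<noteq> 0" for x z
  proof -
    interpret comm_ring_hom "\<lambda>q. eval_xz q x z" by (rule comm_ring_hom_eval_xz)
    have "coeff (map_poly (\<lambda>q. eval_xz q x z) F) (degree F) \<noteq> 0"
      using that l by simp
    then have "map_poly (\<lambda>q. eval_xz q x z) F \<noteq> 0" by (metis coeff_0)
    then show ?thesis by (simp add: eval_xyz_eq_poly poly_roots_finite)
  qed
  have finl: "finite {z. poly l z = 0}" using \<open>l \<noteq> 0\<close> by (rule poly_roots_finite)
  \<comment> \<open>The slice \<open>x = c\<close> can be infinite only if \<open>D\<close> vanishes
    on this plane or if the surface contains a line parallel to the \<open>y\<close>-axis over a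
    point \<open>(c, z)\<close> with \<open>l\<close> zero at \<open>z\<close>.\<close>
  let ?X = "{x. \<forall>z. eval_xz D x z = 0} \<union> (\<Union>z\<in>{z. poly l z = 0}. {x. \<forall>y. eval_xyz F x y z = 0})"
  have "finite {x. \<forall>y. eval_xyz F x y z = 0}" for z
  proof -
    obtain x0 y0 where "eval_xyz F x0 y0 z \<noteq> 0"
      using vanishing_level_imp_dvd[of F z] no_z_factor[of "[:- z, 1:]"] by auto
    then have "finite {x. eval_xyz F x y0 z = 0}" using finite_zeros_eval_xyz_x by blast
    then show ?thesis by (rule rev_finite_subset) auto
  qed
  then have finX: "finite ?X" using finite_vanishing_x[OF \<open>D \<noteq> 0\<close>] finl by auto
  have x: "finite (?C \<inter> {(x, y, z). x = c})" if "c \<notin> ?X" for c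
  proof -
    have 1: "finite {z. eval_xz D c z = 0}"
      using that finite_zeros_eval_xz_z[of D c] by blast
    have 2: "finite {y. eval_xyz F c y z = 0}" for z
      using that fibre[of z c] finite_zeros_eval_xyz_y[of F c z] by (cases "poly l z = 0") auto
    have "finite (\<Union>z\<in>{z. eval_xz D c z = 0}. (\<lambda>y. (c, y, z)) ` {y. eval_xyz F c y z = 0})"
      using 1 2 by blast
    then show ?thesis by (rule rev_finite_subset) auto
  qed
  let ?Z = "{z. \<forall>x. eval_xz D x z = 0} \<union> {z. poly l z = 0}"
  have finZ: "finite ?Z" using finite_vanishing_z[OF \<open>D \<noteq> 0\<close>] finl by simp
  have z: "finite (?C \<inter> {(x, y, z). z = c})" if "c \<notin> ?Z" for c
  proof -
    have 1: "finite {x. eval_xz D x c = 0}"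
      using that finite_zeros_eval_xz_x[of D c] by blast
    have "finite (\<Union>x\<in>{x. eval_xz D x c = 0}. (\<lambda>y. (x, y, c)) ` {y. eval_xyz F x y c = 0})"
      using 1 fibre that by blast
    then show ?thesis by (rule rev_finite_subset) auto
  qed
  txt \<open>If the slice \<open>y = c\<close> is infinite, some prime factor \<open>P\<close> of \<open>D\<close> divides \<open>F(x,c,z)\<close>.  If this
    happened for infinitely many \<open>c\<close> with the same \<open>P\<close>, then \<open>P\<close> would divide \<open>F\<close>, hence its leading
    coefficient, and so depend only on \<open>z\<close>.\<close>
  let ?Y = "\<Union>P\<in>prime_factors D. {c. P dvd poly F [:[:c:]:]}"
  have finY: "finite ?Y"
    using const_dvd_if_dvd_infinitely_many_values const_not_dvd_if_prime[OF deg]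
    by (blast dest: in_prime_factors_imp_prime)
  have y: "finite (?C \<inter> {(x, y, z). y = c})" if "c \<notin> ?Y" for c
  proof -
    let ?G = "poly F [:[:c:]:]"
    have fin: "finite (\<Union>P\<in>prime_factors D. {(x, z). eval_xz P x z = 0 \<and> eval_xz ?G x z = 0})"
      using that by (intro finite_UN_I finite_common_zeros) (auto dest: in_prime_factors_imp_prime)
    have "{(x, z). eval_xz D x z = 0 \<and> eval_xz ?G x z = 0}
        \<subseteq> (\<Union>P\<in>prime_factors D. {(x, z). eval_xz P x z = 0 \<and> eval_xz ?G x z = 0})"
    proof clarify
      fix x z assume 0: "eval_xz D x z = 0" "eval_xz ?G x z = 0"
      then obtain P where "P \<in> prime_factors D" "eval_xz P x z = 0"
        using zero_imp_prime_factor_zero[of "\<lambda>q. eval_xz q x z" D] \<open>D \<noteq> 0\<close> by auto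
      with 0 show "(x, z) \<in> (\<Union>P\<in>prime_factors D. {(x, z). eval_xz P x z = 0 \<and> eval_xz ?G x z = 0})"
        by blast
    qed
    then have "finite ((\<lambda>(x, z). (x, c, z)) ` {(x, z). eval_xz D x z = 0 \<and> eval_xz ?G x z = 0})"
      using fin finite_subset by blast
    then show ?thesis by (rule rev_finite_subset) (auto simp: eval_xyz_eq_eval_xz)
  qed
  show ?thesis
    by (intro axis_thin_2_real3I finite_exceptions[OF finX x] finite_exceptions[OF finY y]
        finite_exceptions[OF finZ z])
qed

lemma surface_real_if_contains_disc:
  fixes h :: "real \<times> real \<Rightarrow> real \<times> real \<times> real"
  assumes "r > 0" "continuous_on (cball p r) h" "inj_on h (cball p r)"
    and "\<And>u. u \<in> cball p r \<Longrightarrow> h u \<in> real_surface_points F"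
  shows "surface_real F"
proof -
  have "h ` cball p r \<subseteq> real_surface_points F" using assms(4) by blast
  then show ?thesis
    using not_dim_le_1_if_contains_disc[OF _ assms(1-3)] by (simp add: surface_real_iff)
qed

text \<open>At a common zero of \<open>F\<close> and its \<open>y\<close>-derivative the
  discriminant vanishes, so here the derivative is nonzero and the implicit function
  applies.\<close>

lemma local_graph_over_xz:
  assumes deg: "degree F > 0"
    and zero: "eval_xyz F x y z = 0" and D: "eval_xz (disc_res F) x z \<noteq> 0"
  obtains r g where "r > 0" "continuous_on (cball (x, z) r) g"
    "\<And>s t. (s, t) \<in> cball (x, z) r \<Longrightarrow> eval_xyz F s (g (s, t)) t = 0"
proof -
  have ne: "eval_xyz (pderiv F) x y z \<noteq> 0"
  proof
    assume "eval_xyz (pderiv F) x y z = 0"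
    then have "eval_xz (resultant F (pderiv F)) x z = 0"
      using zero deg
      by (intro hom_resultant_eq_0_if_common_root[OF comm_ring_hom_eval_xz, of _ _ _ y])
        (simp_all add: eval_xyz_eq_poly)
    with D show False by (simp add: disc_res_def)
  qed
  obtain r g where rg: "r > 0" "continuous_on (cball (x, z) r) g"
    "\<And>u. u \<in> cball (x, z) r \<Longrightarrow> eval_xyz F (fst u) (g u) (snd u) = 0"
  proof (rule implicit_zero_function[of "\<lambda>u y. eval_xyz F (fst u) y (snd u)"
        "\<lambda>u y. eval_xyz (pderiv F) (fst u) y (snd u)" "(x, z)" y])
    show "continuous_on UNIV (\<lambda>(u, y). eval_xyz F (fst u) y (snd u))"
      unfolding case_prod_unfold by (intro continuous_intros)
    show "continuous_on UNIV (\<lambda>(u, y). eval_xyz (pderiv F) (fst u) y (snd u))"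
      unfolding case_prod_unfold by (intro continuous_intros)
    show "((\<lambda>y. eval_xyz F (fst u) y (snd u)) has_real_derivative eval_xyz (pderiv F) (fst u) y (snd u)) (at y)"
      for u y by (rule eval_xyz_has_derivative_y)
  qed (use zero ne in auto)
  show thesis
    by (rule that[OF rg(1,2)]) (use rg(3) in force)
qed

lemma coeff_0_if_degree_0:
  assumes "degree F = 0" "\<nexists>c. F = [:[:[:c:]:]:]"
  shows "F = [:coeff F 0:]" "squarefree (coeff F 0)" "degree (coeff F 0) > 0"
proof -
  show F: "F = [:coeff F 0:]" using assms(1) by (metis degree_0_id)
  show "squarefree (coeff F 0)"
    unfolding squarefree_def
  proof (intro allI impI)
    fix x assume "x\<^sup>2 dvd coeff F 0"
    then have "[:x:]\<^sup>2 dvd F"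
      by (subst F) (auto simp: power2_eq_square const_poly_dvd_iff coeff_pCons split: nat.splits)
    then have "is_unit [:x:]" using sqf unfolding squarefree_def by blast
    then show "is_unit x" by (simp add: is_unit_const_poly_iff)
  qed
  show "degree (coeff F 0) > 0"
  proof (rule ccontr)
    assume "\<not> ?thesis"
    then obtain p where p: "coeff F 0 = [:p:]" by (auto elim: degree_eq_zeroE)
    then have Fp: "F = [:[:p:]:]" using F by simp
    then have "degree p = 0" using no_z_factor[of p] by auto
    then show False using assms(2) Fp by (auto elim: degree_eq_zeroE)
  qed
qed

lemma surface_real_imp_level_if_degree_pos:
  assumes deg: "degree F > 0" "degree (lead_coeff F) = 0" and "finite A" and S: "surface_real F"
  shows "\<exists>a. a \<notin> A \<and> level_curve_real F a"
proof -
  have D: "disc_res F \<noteq> 0" using sqf deg(1) by (rule disc_res_nonzero_if_squarefree)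
  have "\<exists>x y z. eval_xyz F x y z = 0 \<and> eval_xz (disc_res F) x z \<noteq> 0"
  proof (rule ccontr)
    assume "\<not> ?thesis"
    then have "real_surface_points F \<subseteq> {(x, y, z). eval_xyz F x y z = 0 \<and> eval_xz (disc_res F) x z = 0}"
      by (auto simp: real_surface_points_def)
    then have "axis_thin 2 (real_surface_points F)"
      by (rule axis_thin_subset[OF axis_thin_critical_part[OF deg D]])
    then have "top_of_set (real_surface_points F) dim_le 1"
      using axis_thin_imp_dim_le by fastforce
    with S show False by (simp add: surface_real_iff)
  qed
  then obtain x y z where "eval_xyz F x y z = 0" "eval_xz (disc_res F) x z \<noteq> 0" by blast
  then obtain r g where rg: "r > 0" "continuous_on (cball (x, z) r) g"
    "\<And>s t. (s, t) \<in> cball (x, z) r \<Longrightarrow> eval_xyz F s (g (s, t)) t = 0"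
    using local_graph_over_xz[OF deg(1)] by metis
  \<comment> \<open>The bound \<open>r / 2\<close> on both the height difference and the length of
    the segment keeps the segment at level \<open>a\<close> inside the ball of radius
    \<open>r\<close>.\<close>
  obtain a where a: "z < a" "a < z + r / 2" "a \<notin> A"
    using ex_between_avoiding_countable[of z "z + r / 2" A] \<open>r > 0\<close> \<open>finite A\<close> countable_finite by auto
  have mem: "(s, a) \<in> cball (x, z) r" if "s \<in> {x..x + r / 2}" for s
  proof -
    have "dist (x, z) (s, a) \<le> dist x s + dist z a"
      unfolding dist_Pair_Pair by (rule sqrt_sum_squares_le_sum) auto
    also have "\<dots> \<le> r" using that a by (auto simp: dist_real_def)
    finally show ?thesis by simp
  qed
  have "level_curve_real F a"
  proof (rule level_real_if_contains_curve)
    show "continuous_on {x..x + r / 2} (\<lambda>s. (s, g (s, a)))"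
      by (intro continuous_intros continuous_on_compose2[OF rg(2)]) (use mem in auto)
    show "(s, g (s, a)) \<in> real_level_points F a" if "s \<in> {x..x + r / 2}" for s
      using rg(3)[OF mem[OF that]] by (simp add: real_level_points_def)
  qed (use \<open>r > 0\<close> in auto)
  with a show ?thesis by blast
qed

lemma surface_real_imp_level_if_degree_0:
  assumes deg: "degree F = 0" "\<nexists>c. F = [:[:[:c:]:]:]" and S: "surface_real F"
  shows "\<exists>a. poly (disc_res (coeff F 0)) a \<noteq> 0 \<and> level_curve_real F a"
proof -
  define G where "G = coeff F 0"
  have F: "F = [:G:]" and G: "squarefree G" "degree G > 0"
    using coeff_0_if_degree_0[OF deg] by (auto simp: G_def)
  have eval: "eval_xyz F x y z = eval_xz G x z" for x y z
    by (simp add: F eval_xyz_eq_eval_xz)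
  have finD: "finite {z. poly (disc_res G) z = 0}"
    using disc_res_nonzero_if_squarefree[OF G] by (rule poly_roots_finite)
  have finG: "finite {x. eval_xz G x z = 0}" for z
  proof -
    obtain x0 where "eval_xz G x0 z \<noteq> 0"
      using vanishing_level_imp_dvd[of F z] no_z_factor[of "[:- z, 1:]"] by (auto simp: eval)
    then show ?thesis using finite_zeros_eval_xz_x by blast
  qed
  have "\<exists>x z. eval_xz G x z = 0 \<and> poly (disc_res G) z \<noteq> 0"
  proof (rule ccontr)
    assume neg: "\<not> ?thesis"
    \<comment> \<open>Under \<open>neg\<close> the surface lies on finitely many lines parallel to
      the \<open>y\<close>-axis, one over each point of \<open>?K\<close>. Slices in
      \<open>x\<close> and \<open>z\<close> are then empty for almost all values, and slices in
      \<open>y\<close> are always finite.\<close>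
    let ?K = "\<Union>z\<in>{z. poly (disc_res G) z = 0}. (\<lambda>x. (x, z)) ` {x. eval_xz G x z = 0}"
    let ?S = "real_surface_points F"
    have K: "finite ?K" using finD finG by blast
    have S': "(x, z) \<in> ?K" if "(x, y, z) \<in> ?S" for x y z
      using that neg by (auto simp: real_surface_points_def eval)
    have "axis_thin 2 ?S"
    proof (rule axis_thin_2_real3I)
      have "?S \<inter> {(x, y, z). x = c} = {}" if "c \<notin> fst ` ?K" for c
        using that S' by force
      then have "{c. infinite (?S \<inter> {(x, y, z). x = c})} \<subseteq> fst ` ?K" by force
      then show "finite {c. infinite (?S \<inter> {(x, y, z). x = c})}"
        using finite_imageI[OF K] by (rule finite_subset)
      have "?S \<inter> {(x, y, z). z = c} = {}" if "c \<notin> snd ` ?K" for c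
        using that S' by force
      then have "{c. infinite (?S \<inter> {(x, y, z). z = c})} \<subseteq> snd ` ?K" by force
      then show "finite {c. infinite (?S \<inter> {(x, y, z). z = c})}"
        using finite_imageI[OF K] by (rule finite_subset)
      have "?S \<inter> {(x, y, z). y = c} \<subseteq> (\<lambda>(x, z). (x, c, z)) ` ?K" for c
        using S' by force
      then have "finite (?S \<inter> {(x, y, z). y = c})" for c
        using finite_imageI[OF K] by (rule finite_subset)
      then show "finite {c. infinite (?S \<inter> {(x, y, z). y = c})}" by simp
    qed
    then have "top_of_set ?S dim_le 1"
      using axis_thin_imp_dim_le by fastforce
    with S show False by (simp add: surface_real_iff)
  qed
  then obtain x z where xz: "eval_xz G x z = 0" "poly (disc_res G) z \<noteq> 0" by blast
  \<comment> \<open>As \<open>F\<close> does not involve \<open>y\<close>, this level contains the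
    whole line over \<open>(x, z)\<close>.\<close>
  have "level_curve_real F z"
    by (rule level_real_if_contains_curve[of 0 1 "\<lambda>y. (x, y)"])
      (use xz in \<open>auto simp: real_level_points_def eval intro!: continuous_intros\<close>)
  with xz show ?thesis unfolding G_def by blast
qed

lemma level_real_imp_surface_if_degree_pos:
  assumes deg: "degree F > 0" "degree (lead_coeff F) = 0"
    and L: "level_curve_real F a" and x0: "eval_xz (disc_res F) x0 a \<noteq> 0"
  shows "surface_real F"
proof -
  have finD: "finite {x. eval_xz (disc_res F) x a = 0}"
    using finite_zeros_eval_xz_x x0 by blast
  have "eval_xz (lead_coeff F) x0 a \<noteq> 0"
  proof
    assume 0: "eval_xz (lead_coeff F) x0 a = 0"
    have "lead_coeff (pderiv F) = of_nat (degree F) * lead_coeff F"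
      using deg(1) by (simp add: degree_pderiv coeff_pderiv)
    then have "eval_xz (lead_coeff (pderiv F)) x0 a = 0"
      using 0 by simp
    then have "eval_xz (resultant F (pderiv F)) x0 a = 0"
      using 0 deg(1) by (intro hom_resultant_eq_0_if_lead_coeffs[OF comm_ring_hom_eval_xz]) simp_all
    with x0 show False by (simp add: disc_res_def)
  qed
  \<comment> \<open>The leading coefficient is free of \<open>x\<close>, so being nonzero at
    \<open>x0\<close> makes it nonzero on the entire level.\<close>
  then have lc: "eval_xz (lead_coeff F) x a \<noteq> 0" for x
    using deg(2) by (auto elim!: degree_eq_zeroE)
  have fibre: "finite {y. eval_xyz F x y a = 0}" for x
  proof -
    interpret comm_ring_hom "\<lambda>q. eval_xz q x a" by (rule comm_ring_hom_eval_xz)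
    have "map_poly (\<lambda>q. eval_xz q x a) F \<noteq> 0"
      using lc[of x] by (metis coeff_0 coeff_map_poly_hom)
    then show ?thesis by (simp add: eval_xyz_eq_poly poly_roots_finite)
  qed
  have "\<exists>x y. eval_xyz F x y a = 0 \<and> eval_xz (disc_res F) x a \<noteq> 0"
  proof (rule ccontr)
    assume "\<not> ?thesis"
    then have "real_level_points F a
        \<subseteq> (\<Union>x\<in>{x. eval_xz (disc_res F) x a = 0}. (\<lambda>y. (x, y)) ` {y. eval_xyz F x y a = 0})"
      by (auto simp: real_level_points_def)
    moreover have "finite (\<Union>x\<in>{x. eval_xz (disc_res F) x a = 0}. (\<lambda>y. (x, y)) ` {y. eval_xyz F x y a = 0})"
      using finD fibre by blast
    ultimately show False using infinite_level_if_real[OF L] finite_subset by blast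
  qed
  then obtain x y where "eval_xyz F x y a = 0" "eval_xz (disc_res F) x a \<noteq> 0" by blast
  then obtain r g where rg: "r > 0" "continuous_on (cball (x, a) r) g"
    "\<And>s t. (s, t) \<in> cball (x, a) r \<Longrightarrow> eval_xyz F s (g (s, t)) t = 0"
    using local_graph_over_xz[OF deg(1)] by metis
  show ?thesis
  proof (rule surface_real_if_contains_disc[OF rg(1)])
    show "continuous_on (cball (x, a) r) (\<lambda>u. (fst u, g u, snd u))"
      by (intro continuous_intros rg(2))
    show "inj_on (\<lambda>u. (fst u, g u, snd u)) (cball (x, a) r)"
      by (auto simp: inj_on_def)
    show "(fst u, g u, snd u) \<in> real_surface_points F" if "u \<in> cball (x, a) r" for u
      using rg(3)[of "fst u" "snd u"] that by (simp add: real_surface_points_def)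
  qed
qed

text \<open>Near the point found on the level, the curve \<open>G(x,z) = 0\<close> contains a graph
  \<open>x = g z\<close>; its product with the \<open>y\<close>-direction gives a disc in the
  cylinder.\<close>

lemma level_real_imp_surface_if_degree_0:
  assumes deg: "degree F = 0" "\<nexists>c. F = [:[:[:c:]:]:]"
    and L: "level_curve_real F a" and a: "poly (disc_res (coeff F 0)) a \<noteq> 0"
  shows "surface_real F"
proof -
  define G where "G = coeff F 0"
  have F: "F = [:G:]" and G: "degree G > 0"
    using coeff_0_if_degree_0[OF deg] by (auto simp: G_def)
  have eval: "eval_xyz F x y z = eval_xz G x z" for x y z
    by (simp add: F eval_xyz_eq_eval_xz)
  obtain x where x: "eval_xz G x a = 0"
    using infinite_level_if_real[OF L] infinite_imp_nonempty
    by (fastforce simp: real_level_points_def eval)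
  have ne: "eval_xz (pderiv G) x a \<noteq> 0"
  proof
    assume "eval_xz (pderiv G) x a = 0"
    then have "poly (resultant G (pderiv G)) a = 0"
      using x G
      by (intro hom_resultant_eq_0_if_common_root[OF comm_ring_hom_poly, of _ _ x])
        (simp_all add: eval_xz_eq_poly)
    with a show False by (simp add: disc_res_def G_def)
  qed
  obtain r g where rg: "r > 0" "continuous_on (cball a r) g"
    "\<And>z. z \<in> cball a r \<Longrightarrow> eval_xz G (g z) z = 0"
  proof (rule implicit_zero_function[of "\<lambda>z x. eval_xz G x z" "\<lambda>z x. eval_xz (pderiv G) x z" a x])
    show "continuous_on UNIV (\<lambda>(z, x). eval_xz G x z)" "continuous_on UNIV (\<lambda>(z, x). eval_xz (pderiv G) x z)"
      unfolding case_prod_unfold by (intro continuous_intros)+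
    show "((\<lambda>x. eval_xz G x z) has_real_derivative eval_xz (pderiv G) x z) (at x)" for z x
      by (rule eval_xz_has_derivative_x)
  qed (use x ne in auto)
  have fst: "fst u \<in> cball a r" if "u \<in> cball (a, 0 :: real) r" for u
    using that dist_fst_le[of "(a, 0 :: real)" u] unfolding mem_cball fst_conv by (rule order_trans[rotated])
  show ?thesis
  proof (rule surface_real_if_contains_disc[OF rg(1)])
    show "continuous_on (cball (a, 0 :: real) r) (\<lambda>u. (g (fst u), snd u, fst u))"
    proof -
      have "fst ` cball (a, 0 :: real) r \<subseteq> cball a r" using fst by blast
      then have g: "continuous_on (cball (a, 0 :: real) r) (\<lambda>u. g (fst u))"
        by (intro continuous_on_compose2[OF rg(2)] continuous_intros)
      show ?thesis by (intro continuous_intros g)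
    qed
    show "inj_on (\<lambda>u. (g (fst u), snd u, fst u)) (cball (a, 0 :: real) r)"
      by (auto simp: inj_on_def)
    show "(g (fst u), snd u, fst u) \<in> real_surface_points F" if "u \<in> cball (a, 0 :: real) r" for u
      using rg(3)[OF fst[OF that]] by (simp add: real_surface_points_def eval)
  qed
qed

section \<open>Critical levels and the discriminant\<close>

lemma poly_M_nonzero:
  assumes "degree F > 0"
  shows "poly_M F \<noteq> 0"
  using assms disc_res_nonzero_if_squarefree[OF sqf assms] by (simp add: poly_M_def sqfree_part_nonzero)

text \<open>\<open>poly_M F\<close> is square-free by construction, so its discriminant is nonzero.
  Hence \<open>poly_R F\<close> is zero only when \<open>poly_M F\<close> is free of
  \<open>x\<close>.\<close>

lemma poly_R_nonzero:
  assumes "degree (poly_M F) > 0"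
  shows "poly_R F \<noteq> 0"
proof -
  have deg: "degree F > 0" using assms by (cases "degree F = 0") (auto simp: poly_M_def)
  then have "squarefree (poly_M F)"
    using disc_res_nonzero_if_squarefree[OF sqf deg] by (simp add: poly_M_def squarefree_sqfree_part)
  then show ?thesis using assms disc_res_nonzero_if_squarefree by (simp add: poly_R_def)
qed

lemma critical_levels_degree_0:
  assumes "degree F = 0"
  shows "critical_levels F = {a. poly (disc_res (coeff F 0)) a = 0}"
  using assms by (simp add: critical_levels_def poly_R_def poly_M_def)

lemma finite_critical_levels:
  assumes "degree F > 0"
  shows "finite (critical_levels F)"
proof (cases "poly_R F = 0")
  case True
  then have "degree (poly_M F) = 0" using poly_R_nonzero by blast
  then have "coeff (poly_M F) 0 \<noteq> 0"
    using poly_M_nonzero[OF assms] by (metis leading_coeff_0_iff)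
  then show ?thesis
    using True poly_M_nonzero[OF assms] by (simp add: critical_levels_def poly_roots_finite)
qed (simp add: critical_levels_def poly_roots_finite)

lemma disc_nonzero_on_noncritical_level:
  assumes deg: "degree F > 0" and a: "a \<notin> critical_levels F"
  shows "\<exists>x. eval_xz (disc_res F) x a \<noteq> 0"
proof -
  have D: "disc_res F \<noteq> 0" using sqf deg by (rule disc_res_nonzero_if_squarefree)
  have "\<exists>x. eval_xz (poly_M F) x a \<noteq> 0"
  proof (cases "degree (poly_M F) = 0")
    case True
    then obtain m where m: "poly_M F = [:m:]" by (rule degree_eq_zeroE)
    have "poly m a \<noteq> 0"
      using True a m poly_M_nonzero[OF deg] by (simp add: critical_levels_def poly_R_def)
    with m show ?thesis by simp
  next
    case False
    then have R: "poly (resultant (poly_M F) (pderiv (poly_M F))) a \<noteq> 0"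
      using a poly_R_nonzero by (simp add: critical_levels_def poly_R_def disc_res_def)
    show ?thesis
    proof (rule ccontr)
      assume "\<not> ?thesis"
      then have 0: "map_poly (\<lambda>p. poly p a) (poly_M F) = 0"
        by (subst poly_all_0_iff_0[symmetric]) (simp add: eval_xz_eq_poly)
      \<comment> \<open>Both specialised polynomials are zero, so any number is a common root; 0 is
        chosen.\<close>
      then have "poly (resultant (poly_M F) (pderiv (poly_M F))) a = 0"
        using False
        by (intro hom_resultant_eq_0_if_common_root[OF comm_ring_hom_poly, of _ _ 0])
          (simp_all add: map_poly_pderiv_comm_ring_hom[OF comm_ring_hom_poly])
      with R show False by simp
    qed
  qed
  then obtain x where x: "eval_xz (poly_M F) x a \<noteq> 0" by blast
  \<comment> \<open>A zero of the discriminant is a zero of one of its prime factors, and each of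
    these divides \<open>poly_M F\<close>.\<close>
  have "eval_xz (disc_res F) x a \<noteq> 0"
  proof
    assume "eval_xz (disc_res F) x a = 0"
    then obtain P where P: "P \<in> prime_factors (disc_res F)" "eval_xz P x a = 0"
      using zero_imp_prime_factor_zero[of "\<lambda>q. eval_xz q x a" "disc_res F"] D by auto
    then have "P dvd poly_M F"
      using deg D by (auto simp: poly_M_def sqfree_part_def intro: dvd_prodI)
    with P(2) x show False by (auto elim!: dvdE)
  qed
  then show ?thesis by blast
qed

end

theorem theorem5:
  fixes F :: "real poly poly poly"
  assumes nonconstant: "\<nexists>c. F = [:[:[:c:]:]:]"
    and squarefree: "squarefree F"
    and no_z_factor: "\<And>p :: real poly. degree p > 0 \<Longrightarrow> \<not> [:[:p:]:] dvd F"
    and lead_coeff_y: "degree F > 0 \<Longrightarrow> degree (lead_coeff F) = 0"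
  shows "surface_real F \<longleftrightarrow> (\<exists>a. a \<notin> critical_levels F \<and> level_curve_real F a)"
proof -
  interpret surface_polynomial F
    using squarefree no_z_factor by unfold_locales
  show ?thesis
  proof (cases "degree F > 0")
    case True
    note deg = True lead_coeff_y[OF True]
    show ?thesis
      using surface_real_imp_level_if_degree_pos[OF deg finite_critical_levels[OF True]]
        level_real_imp_surface_if_degree_pos[OF deg] disc_nonzero_on_noncritical_level[OF True]
      by blast
  next
    case False
    then have "degree F = 0" by simp
    then show ?thesis
      using surface_real_imp_level_if_degree_0[OF _ nonconstant]
        level_real_imp_surface_if_degree_0[OF _ nonconstant]
      by (auto simp: critical_levels_degree_0)
  qed
qed

end
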